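(* Let $R\subset T$ be the subgroup of Thompson's group $T$ consisting of the rotations $t\mapsto t+d \bmod 1$ with $d$ a dyadic rational, equipped with the 2-adic metric. Then $R$ is quasi-isometrically embedded in $T$, where $T$ carries the word metric with respect to a finite generating set such as $\{x_0,x_1,c_1\}$: there are constants $K>0$ and $C$ such that for all $g,h\in R$, $$\tfrac1K d(g,h)-C\le d_T(g,h)\le K d(g,h)+C,$$ where $d$ is the 2-adic metric on $R$ and $d_T$ is the word metric on $T$.
   Context: Thompson's group $T$ is the group of orientation-preserving piecewise-linear homeomorphisms of $S^1=[0,1]/(0\sim 1)$ with finitely many breakpoints, all slopes powers of $2$, and dyadic breakpoints, mapping dyadic rationals to dyadic rationals. Product convention: $vu=v\circ u$. Generators: $x_0(t)=t/2$ on $[0,\frac12]$, $t-\frac14$ on $[\frac12,\frac34]$, $2t-1$ on $[\frac34,1]$; $x_1$ is the identity on $[0,\frac12]$ and $x_1(t)=\frac12+\frac12x_0(2t-1)$ on $[\frac12,1]$; $c_1(t)=\frac12t+\frac34$ on $[0,\frac12)$, $2t-1$ on $[\frac12,\frac34)$, $t-\frac14$ on $[\frac34,1]$. The group $R$ is identified with the group of dyadic rationals modulo $1$. The 2-adic metric on it: for $x\ne y$ in $R$, represented by dyadic rationals in $[0,1)$, write $|x-y|=\frac{r}{2^k}$ with $r$ odd; then $d(x,y)=2^k$; and $d(x,x)=0$. *)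

theory Defs
  imports "HOL-Analysis.Analysis" "HOL-Algebra.Generated_Groups" "HOL-Algebra.Bij"
begin

section \<open>The circle\<close>

text \<open>
  The circle \<open>S\<^sup>1 = [0,1]/(0 \<sim> 1)\<close> is represented by the set of representatives
  \<open>{0..<1}\<close>. The quotient map is \<open>frac\<close>, restricted to \<open>{0..1}\<close>, and the topology is the
  quotient topology, in which points near \<open>1\<close> are close to \<open>0\<close>.
\<close>

definition circle :: "real set" where
  "circle = {0..<1}"

definition circle_topology :: "real topology" where
  "circle_topology = topology (\<lambda>U. U \<subseteq> circle \<and>
     openin (top_of_set {0..1::real}) {t \<in> {0..1}. frac t \<in> U})"

text \<open>The positively oriented cyclic order on the circle.\<close>

definition cyclic_order :: "real \<Rightarrow> real \<Rightarrow> real \<Rightarrow> bool" where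
  "cyclic_order x y z \<longleftrightarrow> x < y \<and> y < z \<or> y < z \<and> z < x \<or> z < x \<and> x < y"

definition orientation_preserving :: "(real \<Rightarrow> real) \<Rightarrow> bool" where
  "orientation_preserving f \<longleftrightarrow>
     (\<forall>x\<in>circle. \<forall>y\<in>circle. \<forall>z\<in>circle. cyclic_order x y z \<longrightarrow> cyclic_order (f x) (f y) (f z))"

definition dyadic_rationals :: "real set" where
  "dyadic_rationals = {x. \<exists>(a::int) (n::nat). x = of_int a / 2 ^ n}"

text \<open>
  Here \<open>s\<close> ranges over a neighbourhood of \<open>t\<close> in the real line; reducing \<open>s\<close> and the affine
  expression modulo 1 makes the condition one about the circle map \<open>f\<close> (it does not see where
  \<open>f\<close>, or its argument, passes through the base point \<open>0\<close>).
\<close>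

definition locally_affine_at :: "(real \<Rightarrow> real) \<Rightarrow> real \<Rightarrow> real \<Rightarrow> bool" where
  "locally_affine_at f m t \<longleftrightarrow>
     (\<forall>\<^sub>F s in nhds t. f (frac s) = frac (f t + m * (s - t)))"

definition breakpoints :: "(real \<Rightarrow> real) \<Rightarrow> real set" where
  "breakpoints f = {t \<in> circle. \<nexists>m. locally_affine_at f m t}"

section \<open>Thompson's group \<open>T\<close>\<close>

text \<open>
  A homeomorphism of the circle is piecewise linear iff its set of breakpoints is finite.
  Membership in \<^term>\<open>extensional circle\<close> only makes the representing function unique.
\<close>

definition thompson_T_carrier :: "(real \<Rightarrow> real) set" where
  "thompson_T_carrier = {f \<in> extensional circle.
     homeomorphic_map circle_topology circle_topology f \<and>
     orientation_preserving f \<and>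
     finite (breakpoints f) \<and>
     breakpoints f \<subseteq> dyadic_rationals \<and>
     (\<forall>t\<in>circle. \<forall>m. locally_affine_at f m t \<longrightarrow> (\<exists>k::int. m = 2 powi k)) \<and>
     f ` (dyadic_rationals \<inter> circle) \<subseteq> dyadic_rationals}"

text \<open>The product of \<open>v\<close> and \<open>u\<close> is \<open>v \<circ> u\<close> (restricted to \<^term>\<open>circle\<close>).\<close>

definition thompson_T :: "(real \<Rightarrow> real) monoid" where
  "thompson_T = (BijGroup circle)\<lparr>carrier := thompson_T_carrier\<rparr>"

text \<open>
  The formulas for the generators on \<open>[0,1]\<close>, taken on \<open>[0,1)\<close>; at \<open>1\<close> they give \<open>1\<close>
  (for \<open>x\<^sub>0\<close> and \<open>x\<^sub>1\<close>) or agree with the value at \<open>0\<close> (for \<open>c\<^sub>1\<close>).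
\<close>

definition x0 :: "real \<Rightarrow> real" where
  "x0 = (\<lambda>t\<in>circle. if t < 1/2 then t / 2 else if t < 3/4 then t - 1/4 else 2 * t - 1)"

definition x1 :: "real \<Rightarrow> real" where
  "x1 = (\<lambda>t\<in>circle. if t < 1/2 then t else 1/2 + 1/2 * x0 (2 * t - 1))"

definition c1 :: "real \<Rightarrow> real" where
  "c1 = (\<lambda>t\<in>circle. if t < 1/2 then 1/2 * t + 3/4
                    else if t < 3/4 then 2 * t - 1 else t - 1/4)"

section \<open>Word metrics\<close>

definition word_length :: "('a, 'b) monoid_scheme \<Rightarrow> 'a set \<Rightarrow> 'a \<Rightarrow> nat" where
  "word_length G S g = (LEAST n. \<exists>ws. length ws = n \<and> set ws \<subseteq> S \<union> m_inv G ` S \<and>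
     foldr (mult G) ws (one G) = g)"

definition word_dist :: "('a, 'b) monoid_scheme \<Rightarrow> 'a set \<Rightarrow> 'a \<Rightarrow> 'a \<Rightarrow> nat" where
  "word_dist G S g h = word_length G S (inv\<^bsub>G\<^esub> g \<otimes>\<^bsub>G\<^esub> h)"

section \<open>The group \<open>R\<close> of dyadic rotations and its 2-adic metric\<close>

definition rotation :: "real \<Rightarrow> real \<Rightarrow> real" where
  "rotation d = (\<lambda>t\<in>circle. frac (t + d))"

definition dyadic_rotations :: "(real \<Rightarrow> real) set" where
  "dyadic_rotations = rotation ` dyadic_rationals"

text \<open>
  The distance of two dyadic rationals \<open>x, y \<in> [0,1)\<close>; \<open>THE k\<close> is justified by
  \<open>two_adic_dist_eq\<close> below.
\<close>

definition two_adic_dist :: "real \<Rightarrow> real \<Rightarrow> real" where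
  "two_adic_dist x y =
     (if x = y then 0 else 2 ^ (THE k::nat. \<exists>r::int. odd r \<and> \<bar>x - y\<bar> = of_int r / 2 ^ k))"

text \<open>
  A rotation \<open>t \<mapsto> t + d mod 1\<close> is identified with the class of \<open>d\<close> modulo 1, whose
  representative in \<open>[0,1)\<close> is the value of the rotation at \<open>0\<close>.
\<close>

definition rotation_dist :: "(real \<Rightarrow> real) \<Rightarrow> (real \<Rightarrow> real) \<Rightarrow> real" where
  "rotation_dist g h = two_adic_dist (g 0) (h 0)"

section \<open>Basic facts\<close>

text \<open>The topology above is well defined, \<open>T\<close> is a group and \<open>R\<close> is a subgroup of it.\<close>

lemma frac_in_circle [simp]: "frac t \<in> circle"
  by (simp add: circle_def frac_lt_1)

lemma frac_circle [simp]: "t \<in> circle \<Longrightarrow> frac t = t"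
  by (simp add: circle_def frac_eq)

lemma frac_diff_of_int: "frac (y - of_int n) = frac (y :: real)"
  using frac_add_of_int_right[of y "- n"] by simp

lemma istopology_circle:
  "istopology (\<lambda>U. U \<subseteq> circle \<and> openin (top_of_set {0..1::real}) {t \<in> {0..1}. frac t \<in> U})"
proof -
  have 1: "{t \<in> {0..1}. frac t \<in> S \<inter> T} =
      {t \<in> {0..1}. frac t \<in> S} \<inter> {t \<in> {0..1}. frac t \<in> T}" for S T :: "real set"
    by auto
  have 2: "{t \<in> {0..1}. frac t \<in> \<Union>K} = (\<Union>S\<in>K. {t \<in> {0..1}. frac t \<in> S})"
    for K :: "real set set"
    by auto
  show ?thesis
    unfolding istopology_def 1 2 by (blast intro: openin_Int openin_Union)
qed

lemma openin_circle:
  "openin circle_topology U \<longleftrightarrow>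
     U \<subseteq> circle \<and> openin (top_of_set {0..1::real}) {t \<in> {0..1}. frac t \<in> U}"
  unfolding circle_topology_def topology_inverse'[OF istopology_circle] ..

lemma topspace_circle [simp]: "topspace circle_topology = circle"
proof -
  have "{t \<in> {0..1::real}. frac t \<in> circle} = {0..1}"
    by auto
  then have "openin circle_topology circle"
    by (simp add: openin_circle)
  then show ?thesis
    by (meson openin_circle openin_subset openin_topspace subset_antisym)
qed

lemma quotient_map_frac: "quotient_map (top_of_set {0..1}) circle_topology frac"
proof -
  have "frac ` {0..1} = circle"
  proof
    show "circle \<subseteq> frac ` {0..1}"
      by (rule subsetI, rule_tac x=x in image_eqI) (auto simp: circle_def)
  qed auto
  then show ?thesis
    by (auto simp: quotient_map_def openin_circle)
qed

lemma continuous_map_frac: "continuous_map euclidean circle_topology frac"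
proof -
  have "open {s. frac s \<in> U}" if "openin circle_topology U" for U
  proof -
    from that obtain W where W: "open W" "{t \<in> {0..1}. frac t \<in> U} = {0..1} \<inter> W"
      unfolding openin_circle openin_open by auto
    have iff: "frac t \<in> U \<longleftrightarrow> t \<in> W" if "0 \<le> t" "t \<le> 1" for t
    proof -
      have "t \<in> {t \<in> {0..1}. frac t \<in> U} \<longleftrightarrow> t \<in> {0..1} \<inter> W"
        by (simp only: W(2))
      with that show ?thesis by (simp only: mem_Collect_eq Int_iff atLeastAtMost_iff simp_thms)
    qed
    show ?thesis
      unfolding open_dist
    proof
      fix s assume "s \<in> {s. frac s \<in> U}"
      then have s: "frac s \<in> U" by simp
      show "\<exists>e>0. \<forall>y. dist y s < e \<longrightarrow> y \<in> {s. frac s \<in> U}"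
      proof (cases "s \<in> \<int>")
        case False
        define n where "n = \<lfloor>s\<rfloor>"
        have fr: "frac s = s - n" "0 < frac s" "frac s < 1"
          using False by (simp_all add: n_def frac_lt_1) (simp add: frac_def)
        have "frac s \<in> W \<inter> {0<..<1}"
          using iff[of "frac s"] s fr by auto
        moreover have "open (W \<inter> {0<..<1})"
          using W by auto
        ultimately obtain e where e: "e > 0" "\<And>y. dist y (frac s) < e \<Longrightarrow> y \<in> W \<inter> {0<..<1}"
          unfolding open_dist by meson
        have "frac y \<in> U" if "dist y s < e" for y
        proof -
          have "y - n \<in> W \<inter> {0<..<1}"
            using e(2)[of "y - n"] that fr by (simp add: dist_real_def)
          then have "frac (y - n) \<in> U" using iff[of "y - n"] by auto
          then show ?thesis by (simp add: frac_diff_of_int)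
        qed
        then show ?thesis using e by auto
      next
        case True
        then obtain n where n: "s = of_int n" by (auto elim: Ints_cases)
        have U0: "0 \<in> U" using s n by simp
        have "0 \<in> W" "1 \<in> W"
          using U0 iff[of 0] iff[of 1] by auto
        then obtain e1 e2 where e: "e1 > 0" "\<And>y. dist y 0 < e1 \<Longrightarrow> y \<in> W"
          "e2 > 0" "\<And>y. dist y 1 < e2 \<Longrightarrow> y \<in> W"
          using W(1) unfolding open_dist by meson
        have "frac y \<in> U" if d: "dist y s < min 1 (min e1 e2)" for y
        proof (cases "y \<ge> s")
          case True
          have "y - n \<in> W" using e(2)[of "y - n"] d n by (simp add: dist_real_def)
          then have "frac (y - n) \<in> U"
            using iff[of "y - n"] d n True by (auto simp: dist_real_def)
          then show ?thesis by (simp add: n frac_diff_of_int)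
        next
          case False
          have "y - n + 1 \<in> W" using e(4)[of "y - n + 1"] d n by (simp add: dist_real_def)
          then have "frac (y - n + 1) \<in> U"
            using iff[of "y - n + 1"] d n False by (auto simp: dist_real_def)
          then show ?thesis by (simp add: n frac_diff_of_int frac_1_eq)
        qed
        then show ?thesis using e
          by (intro exI[of _ "min 1 (min e1 e2)"]) auto
      qed
    qed
  qed
  then show ?thesis
    by (auto simp: continuous_map)
qed

lemma continuous_map_rotation: "continuous_map circle_topology circle_topology (rotation d)"
proof (rule continuous_compose_quotient_map[OF quotient_map_frac])
  have "continuous_map (top_of_set {0..1}) circle_topology (frac \<circ> (\<lambda>t. t + d))"
    by (rule continuous_map_compose[OF _ continuous_map_frac]) (auto intro!: continuous_intros)
  moreover have "rotation d \<circ> frac = frac \<circ> (\<lambda>t. t + d)"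
    by (auto simp: rotation_def fun_eq_iff)
  ultimately show "continuous_map (top_of_set {0..1}) circle_topology (rotation d \<circ> frac)"
    by simp
qed

lemma rotation_rotation: "t \<in> circle \<Longrightarrow> rotation d (rotation e t) = rotation (d + e) t"
  by (simp add: rotation_def ac_simps)

lemma rotation_0: "t \<in> circle \<Longrightarrow> rotation 0 t = t"
  by (simp add: rotation_def)

lemma homeomorphic_map_rotation:
  "homeomorphic_map circle_topology circle_topology (rotation d)"
proof -
  have "homeomorphic_maps circle_topology circle_topology (rotation d) (rotation (- d))"
    by (simp add: homeomorphic_maps_def continuous_map_rotation rotation_rotation rotation_0)
  then show ?thesis
    using homeomorphic_map_maps by blast
qed

lemma dyadics_add: "x \<in> dyadic_rationals \<Longrightarrow> y \<in> dyadic_rationals \<Longrightarrow> x + y \<in> dyadic_rationals"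
proof -
  assume "x \<in> dyadic_rationals" "y \<in> dyadic_rationals"
  then obtain a n b m where xy: "x = of_int a / 2 ^ n" "y = of_int b / 2 ^ m"
    unfolding dyadic_rationals_def by blast
  then have "x + y = of_int (a * 2 ^ m + b * 2 ^ n) / 2 ^ (n + m)"
    unfolding xy by (simp add: field_simps power_add)
  then show ?thesis
    unfolding dyadic_rationals_def by blast
qed

lemma dyadics_of_int [simp]: "of_int n \<in> dyadic_rationals"
proof -
  have "of_int n = of_int n / (2::real) ^ 0" by simp
  then show ?thesis
    unfolding dyadic_rationals_def by blast
qed

lemma dyadics_mult: "x \<in> dyadic_rationals \<Longrightarrow> y \<in> dyadic_rationals \<Longrightarrow> x * y \<in> dyadic_rationals"
proof -
  assume "x \<in> dyadic_rationals" "y \<in> dyadic_rationals"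
  then obtain a n b m where xy: "x = of_int a / 2 ^ n" "y = of_int b / 2 ^ m"
    unfolding dyadic_rationals_def by blast
  then have "x * y = of_int (a * b) / 2 ^ (n + m)"
    unfolding xy by (simp add: field_simps power_add)
  then show ?thesis
    unfolding dyadic_rationals_def by blast
qed

lemma dyadics_0 [simp]: "0 \<in> dyadic_rationals"
  using dyadics_of_int[of 0] by simp

lemma dyadics_minus: "x \<in> dyadic_rationals \<Longrightarrow> - x \<in> dyadic_rationals"
  using dyadics_mult[of "of_int (-1)" x] dyadics_of_int by (metis dyadics_of_int mult_minus1 of_int_1 of_int_minus)

lemma dyadics_diff: "x \<in> dyadic_rationals \<Longrightarrow> y \<in> dyadic_rationals \<Longrightarrow> x - y \<in> dyadic_rationals"
  using dyadics_add[of x "- y"] dyadics_minus by simp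

lemma dyadics_frac: "frac x \<in> dyadic_rationals \<longleftrightarrow> x \<in> dyadic_rationals"
  by (metis add_diff_cancel_right' diff_add_cancel dyadics_add dyadics_diff dyadics_of_int frac_def)

lemma dyadics_powi [simp]: "2 powi k \<in> dyadic_rationals"
proof (cases "k \<ge> 0")
  case True
  then have "2 powi k = (of_int (2 ^ nat k) :: real)"
    by (simp add: power_int_def)
  then show ?thesis
    using dyadics_of_int by metis
next
  case False
  then have "2 powi k = of_int 1 / (2::real) ^ nat (- k)"
    by (simp add: power_int_def power_one_over)
  then show ?thesis
    unfolding dyadic_rationals_def by blast
qed

lemma frac_eq_nearby:
  fixes a b :: real
  assumes "frac a = frac b" "\<bar>a - b\<bar> < 1"
  shows "a = b"
proof -
  have "a - b = of_int (\<lfloor>a\<rfloor> - \<lfloor>b\<rfloor>)"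
    using assms(1) by (simp add: frac_def)
  moreover from this assms(2) have "\<lfloor>a\<rfloor> - \<lfloor>b\<rfloor> = 0"
    by linarith
  ultimately show ?thesis by simp
qed

lemma frac_add_frac_left: "frac (frac a + b) = frac (a + b)" for a b :: real
  by simp

lemma locally_affine_unique:
  assumes "locally_affine_at f m t" "locally_affine_at f m' t"
  shows "m = m'"
proof -
  have "\<forall>\<^sub>F s in nhds t. frac (f t + m * (s - t)) = frac (f t + m' * (s - t))"
    using assms unfolding locally_affine_at_def by eventually_elim simp
  moreover have "\<forall>\<^sub>F s in nhds t. \<bar>(m - m') * (s - t)\<bar> < 1"
  proof -
    have "((\<lambda>s. \<bar>(m - m') * (s - t)\<bar>) \<longlongrightarrow> \<bar>(m - m') * (t - t)\<bar>) (nhds t)"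
      by (intro tendsto_intros filterlim_ident)
    then show ?thesis
      by (rule order_tendstoD) auto
  qed
  ultimately have "\<forall>\<^sub>F s in nhds t. (m - m') * (s - t) = 0"
  proof eventually_elim
    case (elim s)
    have "f t + m * (s - t) = f t + m' * (s - t)"
      by (rule frac_eq_nearby) (use elim in \<open>auto simp: algebra_simps\<close>)
    then show ?case by (simp add: algebra_simps)
  qed
  then have "\<forall>\<^sub>F s in at t. m = m'"
    unfolding eventually_at_filter by eventually_elim auto
  then show ?thesis by simp
qed

lemma locally_affine_compose:
  assumes f: "locally_affine_at f m t" and g: "locally_affine_at g m' (f t)"
    and t: "t \<in> circle" and fc: "f \<in> circle \<rightarrow> circle"
  shows "locally_affine_at (compose circle g f) (m' * m) t"
proof -
  have "filterlim (\<lambda>s. f t + m * (s - t)) (nhds (f t + m * (t - t))) (nhds t)"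
    by (intro tendsto_intros filterlim_ident)
  then have "filterlim (\<lambda>s. f t + m * (s - t)) (nhds (f t)) (nhds t)"
    by simp
  from filterlim_iff[THEN iffD1, OF this, rule_format, OF g[unfolded locally_affine_at_def]]
  have "\<forall>\<^sub>F s in nhds t. g (frac (f t + m * (s - t))) = frac (g (f t) + m' * (m * (s - t)))"
    by simp
  with f[unfolded locally_affine_at_def] show ?thesis
    unfolding locally_affine_at_def
    by eventually_elim (simp add: compose_def t mult.assoc)
qed

lemma locally_affine_nearby:
  assumes "locally_affine_at f m t" "t \<in> circle"
  shows "\<forall>\<^sub>F s in nhds t. locally_affine_at f m (frac s)"
proof -
  from assms(1) obtain U where U: "open U" "t \<in> U"
    "\<And>s. s \<in> U \<Longrightarrow> f (frac s) = frac (f t + m * (s - t))"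
    unfolding locally_affine_at_def eventually_nhds by blast
  have "locally_affine_at f m (frac s)" if s: "s \<in> U" for s
  proof -
    define n where "n = real_of_int \<lfloor>s\<rfloor>"
    have n: "frac s = s - n" by (simp add: n_def frac_def)
    have "filterlim (\<lambda>u. u + n) (nhds (frac s + n)) (nhds (frac s))"
      by (intro tendsto_intros filterlim_ident)
    then have "filterlim (\<lambda>u. u + n) (nhds s) (nhds (frac s))"
      using n by simp
    moreover have "\<forall>\<^sub>F u in nhds s. u \<in> U"
      using U(1) s eventually_nhds by blast
    ultimately have "\<forall>\<^sub>F u in nhds (frac s). u + n \<in> U"
      unfolding filterlim_iff by blast
    then show ?thesis
      unfolding locally_affine_at_def
    proof eventually_elim
      case (elim u)
      have "f (frac u) = f (frac (u + n))"
        by (simp add: n_def)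
      also have "\<dots> = frac (f t + m * (u + n - t))"
        using U(3) elim by blast
      also have "\<dots> = frac (f t + m * (s - t) + m * (u - frac s))"
        by (simp add: n algebra_simps)
      also have "\<dots> = frac (f (frac s) + m * (u - frac s))"
        using U(3)[OF s] by simp
      finally show ?case .
    qed
  qed
  then show ?thesis
    unfolding eventually_nhds using U by blast
qed

lemma T_D:
  assumes "f \<in> thompson_T_carrier"
  shows "f \<in> extensional circle"
    "homeomorphic_map circle_topology circle_topology f" "orientation_preserving f"
    "finite (breakpoints f)" "breakpoints f \<subseteq> dyadic_rationals"
    "\<And>t m. t \<in> circle \<Longrightarrow> locally_affine_at f m t \<Longrightarrow> \<exists>k::int. m = 2 powi k"
    "\<And>t. t \<in> circle \<Longrightarrow> t \<in> dyadic_rationals \<Longrightarrow> f t \<in> dyadic_rationals"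
    "bij_betw f circle circle" "f \<in> circle \<rightarrow> circle" "f \<in> Bij circle"
proof -
  show "bij_betw f circle circle"
    using assms unfolding thompson_T_carrier_def
    by (auto simp: homeomorphic_eq_everything_map bij_betw_def)
  then show "f \<in> circle \<rightarrow> circle" "f \<in> Bij circle"
    using assms by (auto simp: bij_betw_imp_funcset Bij_def thompson_T_carrier_def)
qed (use assms in \<open>auto simp: thompson_T_carrier_def\<close>)

lemma slope_powi_2:
  assumes fin: "finite B"
    and B: "\<And>s. s \<in> circle \<Longrightarrow> s \<notin> B \<Longrightarrow> \<exists>k::int. locally_affine_at h (2 powi k) s"
    and m: "locally_affine_at h m t" and t: "t \<in> circle"
  shows "\<exists>k::int. m = 2 powi k"
proof -
  from locally_affine_nearby[OF m t] obtain e where e: "e > 0"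
    "\<And>s. dist s t < e \<Longrightarrow> locally_affine_at h m (frac s)"
    unfolding eventually_nhds_metric by blast
  have t1: "0 \<le> t" "t < 1" using t by (auto simp: circle_def)
  have "infinite {t<..<min 1 (t + e)}"
    using t1 e(1) by simp
  then obtain s where s: "s \<in> {t<..<min 1 (t + e)}" "s \<notin> B"
    using fin by (meson finite_subset subsetI)
  have sc: "s \<in> circle" using s t1 by (auto simp: circle_def)
  have "locally_affine_at h m s"
    using e(2)[of s] s sc by (auto simp: dist_real_def)
  then show ?thesis
    using B[OF sc s(2)] locally_affine_unique by blast
qed

lemma T_dyadics:
  assumes f: "f \<in> thompson_T_carrier" and t: "t \<in> circle" "f t \<in> dyadic_rationals"
  shows "t \<in> dyadic_rationals"
proof (cases "t \<in> breakpoints f")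
  case False
  then obtain m where m: "locally_affine_at f m t"
    using t by (auto simp: breakpoints_def)
  then obtain k :: int where k: "m = 2 powi k"
    using T_D(6)[OF f] t by blast
  from m obtain e where e: "e > 0"
    "\<And>s. dist s t < e \<Longrightarrow> f (frac s) = frac (f t + m * (s - t))"
    unfolding locally_affine_at_def eventually_nhds_metric by blast
  obtain n where n: "(1/2::real) ^ n < e"
    using real_arch_pow_inv[OF e(1), of "1/2"] by auto
  define s where "s = of_int \<lfloor>t * 2 ^ n\<rfloor> / (2::real) ^ n"
  have s: "s \<in> dyadic_rationals"
    unfolding s_def dyadic_rationals_def by blast
  have "\<bar>s - t\<bar> = \<bar>of_int \<lfloor>t * 2 ^ n\<rfloor> - t * 2 ^ n\<bar> / 2 ^ n"
    by (simp add: s_def abs_if field_simps)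
  also have "\<dots> \<le> 1 / 2 ^ n"
    by (intro divide_right_mono) (auto, linarith)
  finally have "dist s t < e"
    using n by (simp add: dist_real_def power_one_over)
  then have "f (frac s) = frac (f t + m * (s - t))"
    using e by blast
  moreover have "f (frac s) \<in> dyadic_rationals"
    using T_D(7)[OF f, of "frac s"] s dyadics_frac by simp
  ultimately have "f t + m * (s - t) \<in> dyadic_rationals"
    using dyadics_frac by metis
  then have "2 powi (- k) * (f t + m * (s - t) - f t) \<in> dyadic_rationals"
    using t dyadics_mult dyadics_diff dyadics_powi by blast
  moreover have "2 powi (- k) * (f t + m * (s - t) - f t) = s - t"
    by (simp add: k power_int_minus)
  ultimately have "s - (s - t) \<in> dyadic_rationals"
    using s dyadics_diff by metis
  then show ?thesis by simp
qed (use T_D(5)[OF f] in auto)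

lemma T_compose:
  assumes g: "g \<in> thompson_T_carrier" and f: "f \<in> thompson_T_carrier"
  shows "compose circle g f \<in> thompson_T_carrier"
proof -
  note G = T_D[OF g] and F = T_D[OF f]
  define h where "h = compose circle g f"
  have h: "h t = g (f t)" if "t \<in> circle" for t
    using that by (simp add: h_def compose_def)
  have bp: "breakpoints h \<subseteq> breakpoints f \<union> (circle \<inter> f -` breakpoints g)"
    using locally_affine_compose[OF _ _ _ F(9)] F(9) unfolding breakpoints_def h_def
    by blast
  have fin: "finite (circle \<inter> f -` breakpoints g)"
    using finite_vimage_IntI[OF G(4), of f circle] F(8)
    by (simp add: bij_betw_def Int_commute)
  note dy = T_dyadics[OF f]
  have "homeomorphic_map circle_topology circle_topology h"
  proof (rule homeomorphic_map_eq)
    show "homeomorphic_map circle_topology circle_topology (g \<circ> f)"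
      by (rule homeomorphic_map_compose[OF F(2) G(2)])
  qed (simp add: h)
  moreover have "orientation_preserving h"
    using G(3) F(3) F(9) unfolding orientation_preserving_def by (auto simp: h Pi_iff)
  moreover have "finite (breakpoints h)"
    using bp fin F(4) finite_subset by blast
  moreover have "breakpoints h \<subseteq> dyadic_rationals"
    using bp F(5) G(5) dy by blast
  moreover have "\<exists>k::int. m = 2 powi k" if t: "t \<in> circle" and m: "locally_affine_at h m t" for t m
  proof (rule slope_powi_2[OF _ _ m t])
    show "finite (breakpoints f \<union> (circle \<inter> f -` breakpoints g))"
      using fin F(4) by simp
    fix s assume s: "s \<in> circle" "s \<notin> breakpoints f \<union> (circle \<inter> f -` breakpoints g)"
    obtain a where a: "locally_affine_at f a s"
      using s by (auto simp: breakpoints_def)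
    have fs: "f s \<in> circle" using F(9) s by auto
    then obtain b where b: "locally_affine_at g b (f s)"
      using s by (auto simp: breakpoints_def)
    obtain i j :: int where ij: "a = 2 powi i" "b = 2 powi j"
      using F(6)[OF s(1) a] G(6)[OF fs b] by blast
    have "locally_affine_at h (b * a) s"
      using locally_affine_compose[OF a b s(1) F(9)] by (simp add: h_def)
    moreover have "b * a = 2 powi (j + i)"
      by (simp add: ij power_int_add)
    ultimately show "\<exists>k::int. locally_affine_at h (2 powi k) s"
      by metis
  qed
  moreover have "h ` (dyadic_rationals \<inter> circle) \<subseteq> dyadic_rationals"
    using F(7,9) G(7) by (auto simp: h)
  ultimately show ?thesis
    unfolding thompson_T_carrier_def h_def by auto
qed

lemma T_inverse:
  assumes f: "f \<in> thompson_T_carrier"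
  shows "restrict (inv_into circle f) circle \<in> thompson_T_carrier"
proof -
  note F = T_D[OF f]
  define h where "h = restrict (inv_into circle f) circle"
  have hf: "h (f t) = t" if "t \<in> circle" for t
    using that F(8,9) by (auto simp: h_def bij_betw_def Pi_iff)
  have fh: "f (h u) = u" and hc: "h u \<in> circle" if "u \<in> circle" for u
    using that F(8) by (auto simp: h_def bij_betw_def f_inv_into_f inv_into_into)
  have aff: "locally_affine_at h (inverse m) (f t)"
    if t: "t \<in> circle" and m: "locally_affine_at f m t" "m \<noteq> 0" for t m
  proof -
    have "filterlim (\<lambda>u. t + inverse m * (u - f t)) (nhds (t + inverse m * (f t - f t))) (nhds (f t))"
      by (intro tendsto_intros filterlim_ident)
    then have "filterlim (\<lambda>u. t + inverse m * (u - f t)) (nhds t) (nhds (f t))"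
      by simp
    from filterlim_iff[THEN iffD1, OF this, rule_format, OF m(1)[unfolded locally_affine_at_def]]
    show ?thesis
      unfolding locally_affine_at_def
    proof eventually_elim
      case (elim u)
      then have "f (frac (t + inverse m * (u - f t))) = frac u"
        using m(2) by (simp add: field_simps)
      then have "h (frac u) = frac (t + inverse m * (u - f t))"
        using hf[of "frac (t + inverse m * (u - f t))"] by simp
      then show ?case by (simp add: hf t)
    qed
  qed
  have aff': "\<exists>k::int. locally_affine_at h (2 powi k) u"
    if u: "u \<in> circle" "u \<notin> f ` breakpoints f" for u
  proof -
    have "h u \<notin> breakpoints f"
      using u fh by force
    then obtain m where m: "locally_affine_at f m (h u)"
      using hc u by (auto simp: breakpoints_def)
    obtain k :: int where k: "m = 2 powi k"
      using F(6)[OF hc[OF u(1)] m] by blast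
    have "locally_affine_at h (inverse m) u"
      using aff[OF hc[OF u(1)] m] k fh[OF u(1)] by simp
    moreover have "inverse m = 2 powi (- k)"
      by (simp add: k power_int_minus)
    ultimately show ?thesis by metis
  qed
  have bp: "breakpoints h \<subseteq> f ` breakpoints f"
    using aff' unfolding breakpoints_def by blast
  have fin: "finite (f ` breakpoints f)"
    using F(4) by simp
  have "h \<in> extensional circle"
    by (simp add: h_def)
  moreover have "homeomorphic_map circle_topology circle_topology h"
  proof -
    obtain g where g: "homeomorphic_maps circle_topology circle_topology f g"
      using F(2) homeomorphic_map_maps by blast
    show ?thesis
    proof (rule homeomorphic_map_eq)
      show "homeomorphic_map circle_topology circle_topology g"
        using g homeomorphic_maps_map by blast
      fix u assume "u \<in> topspace circle_topology"
      then have "u \<in> circle" by simp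
      then show "g u = h u"
        using g fh hc unfolding homeomorphic_maps_def by (metis topspace_circle)
    qed
  qed
  moreover have "orientation_preserving h"
    unfolding orientation_preserving_def
  proof (intro ballI impI)
    fix x y z assume xyz: "x \<in> circle" "y \<in> circle" "z \<in> circle" "cyclic_order x y z"
    show "cyclic_order (h x) (h y) (h z)"
    proof (rule ccontr)
      assume "\<not> cyclic_order (h x) (h y) (h z)"
      moreover have "h x \<noteq> h y" "h y \<noteq> h z" "h x \<noteq> h z"
        using xyz fh unfolding cyclic_order_def by (metis less_irrefl less_trans)+
      ultimately have "cyclic_order (h x) (h z) (h y)"
        unfolding cyclic_order_def by linarith
      then have "cyclic_order x z y"
        using F(3) xyz fh hc unfolding orientation_preserving_def by metis
      with xyz show False
        unfolding cyclic_order_def by linarith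
    qed
  qed
  moreover have "finite (breakpoints h)"
    using bp fin finite_subset by blast
  moreover have "breakpoints h \<subseteq> dyadic_rationals"
  proof
    fix u assume "u \<in> breakpoints h"
    then obtain t where t: "t \<in> breakpoints f" "u = f t"
      using bp by blast
    then have "t \<in> circle" "t \<in> dyadic_rationals"
      using F(5) by (auto simp: breakpoints_def)
    then show "u \<in> dyadic_rationals"
      using F(7) t by simp
  qed
  moreover have "\<exists>k::int. m = 2 powi k" if "t \<in> circle" "locally_affine_at h m t" for t m
    using slope_powi_2[OF fin aff'] that by blast
  moreover have "h ` (dyadic_rationals \<inter> circle) \<subseteq> dyadic_rationals"
    using T_dyadics[OF f hc] fh by auto
  ultimately show ?thesis
    unfolding thompson_T_carrier_def h_def by auto
qed

lemma locally_affine_rotation: "t \<in> circle \<Longrightarrow> locally_affine_at (rotation d) 1 t"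
proof -
  assume t: "t \<in> circle"
  have "rotation d (frac s) = frac (rotation d t + 1 * (s - t))" for s
  proof -
    have "frac (frac (t + d) + (s - t)) = frac (t + d + (s - t))"
      by (rule frac_add_frac_left)
    then show ?thesis
      using t by (simp add: rotation_def add.commute)
  qed
  then show ?thesis
    by (simp add: locally_affine_at_def)
qed

lemma orientation_preserving_rotation: "orientation_preserving (rotation d)"
proof -
  define e where "e = frac d"
  have e: "0 \<le> e" "e < 1" by (auto simp: e_def frac_lt_1)
  have "rotation d t = (if t + e < 1 then t + e else t + e - 1)" if "t \<in> circle" for t
  proof -
    have "frac (t + d) = frac (t + e)" by (simp add: e_def)
    moreover have "frac (t + e) = frac (t + e - 1)"
      using frac_1_eq[of "t + e - 1"] by simp
    moreover have "frac (t + e) = t + e" if "t + e < 1"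
      using that \<open>t \<in> circle\<close> e by (simp add: frac_eq circle_def)
    moreover have "frac (t + e - 1) = t + e - 1" if "\<not> t + e < 1"
      using that \<open>t \<in> circle\<close> e by (simp add: frac_eq circle_def)
    ultimately show ?thesis
      using that by (simp add: rotation_def)
  qed
  then show ?thesis
    using e unfolding orientation_preserving_def cyclic_order_def circle_def by auto
qed

lemma rotation_in_T:
  assumes "d \<in> dyadic_rationals"
  shows "rotation d \<in> thompson_T_carrier"
proof -
  have "breakpoints (rotation d) = {}"
    using locally_affine_rotation by (auto simp: breakpoints_def)
  moreover have "\<exists>k::int. m = 2 powi k"
    if "t \<in> circle" "locally_affine_at (rotation d) m t" for t m
    using locally_affine_unique[OF that(2) locally_affine_rotation[OF that(1)]]
    by (intro exI[of _ 0]) simp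
  moreover have "rotation d ` (dyadic_rationals \<inter> circle) \<subseteq> dyadic_rationals"
    using assms by (auto simp: rotation_def dyadics_frac intro: dyadics_add)
  moreover have "rotation d \<in> extensional circle"
    by (simp add: rotation_def)
  ultimately show ?thesis
    unfolding thompson_T_carrier_def
    using homeomorphic_map_rotation orientation_preserving_rotation by auto
qed

lemma subgroup_T: "subgroup thompson_T_carrier (BijGroup circle)"
proof
  show "thompson_T_carrier \<subseteq> carrier (BijGroup circle)"
    using T_D(10) by (auto simp: BijGroup_def)
  show "x \<otimes>\<^bsub>BijGroup circle\<^esub> y \<in> thompson_T_carrier"
    if "x \<in> thompson_T_carrier" "y \<in> thompson_T_carrier" for x y
    using that T_compose by (simp add: BijGroup_def T_D(10))
  have "rotation 0 = (\<lambda>x\<in>circle. x)"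
    by (auto simp: rotation_def fun_eq_iff restrict_def)
  then show "\<one>\<^bsub>BijGroup circle\<^esub> \<in> thompson_T_carrier"
    using rotation_in_T[of 0] by (simp add: BijGroup_def)
  show "inv\<^bsub>BijGroup circle\<^esub> x \<in> thompson_T_carrier" if "x \<in> thompson_T_carrier" for x
    using that T_inverse by (simp add: inv_BijGroup T_D(10))
qed

theorem group_thompson_T: "group thompson_T"
  unfolding thompson_T_def by (rule group.subgroup_imp_group[OF group_BijGroup subgroup_T])

lemma mult_rotation:
  "d \<in> dyadic_rationals \<Longrightarrow> e \<in> dyadic_rationals \<Longrightarrow>
     rotation d \<otimes>\<^bsub>thompson_T\<^esub> rotation e = rotation (d + e)"
  using rotation_in_T[THEN T_D(10)] rotation_rotation
  by (auto simp: thompson_T_def BijGroup_def compose_def fun_eq_iff rotation_def)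

lemma one_thompson_T: "\<one>\<^bsub>thompson_T\<^esub> = rotation 0"
  by (auto simp: thompson_T_def BijGroup_def rotation_def fun_eq_iff restrict_def)

theorem subgroup_dyadic_rotations: "subgroup dyadic_rotations thompson_T"
proof (rule group.subgroupI[OF group_thompson_T])
  show sub: "dyadic_rotations \<subseteq> carrier thompson_T"
    using rotation_in_T by (auto simp: dyadic_rotations_def thompson_T_def)
  show "dyadic_rotations \<noteq> {}"
    unfolding dyadic_rotations_def using dyadics_0 by blast
  show "inv\<^bsub>thompson_T\<^esub> g \<in> dyadic_rotations" if "g \<in> dyadic_rotations" for g
  proof -
    from that obtain d where d: "d \<in> dyadic_rationals" "g = rotation d"
      by (auto simp: dyadic_rotations_def)
    have "rotation (- d) \<otimes>\<^bsub>thompson_T\<^esub> g = \<one>\<^bsub>thompson_T\<^esub>"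
      using d by (simp add: mult_rotation dyadics_minus one_thompson_T)
    then have "inv\<^bsub>thompson_T\<^esub> g = rotation (- d)"
      using group.inv_equality[OF group_thompson_T] sub d dyadics_minus that
      by (metis dyadic_rotations_def image_eqI subsetD)
    then show ?thesis
      using d dyadics_minus by (auto simp: dyadic_rotations_def)
  qed
  show "g \<otimes>\<^bsub>thompson_T\<^esub> h \<in> dyadic_rotations"
    if "g \<in> dyadic_rotations" "h \<in> dyadic_rotations" for g h
    using that mult_rotation dyadics_add by (auto simp: dyadic_rotations_def)
qed

lemma rotation_at_0: "d \<in> circle \<Longrightarrow> rotation d 0 = d"
  by (simp add: rotation_def) (simp add: circle_def)

lemma two_adic_dist_eq:
  assumes "odd (r::int)" "\<bar>x - y\<bar> = of_int r / 2 ^ k"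
  shows "two_adic_dist x y = 2 ^ k"
proof -
  have *: False
    if h: "odd a" "odd b" "of_int a / (2::real) ^ i = of_int b / 2 ^ j" "i < j"
    for a b :: int and i j :: nat
  proof -
    obtain l where l: "j = i + Suc l"
      using less_imp_Suc_add[OF h(4)] by auto
    have "of_int a * (2::real) ^ Suc l = of_int b"
      using h(3) by (simp add: l field_simps power_add)
    then have "of_int (a * 2 ^ Suc l) = (of_int b :: real)"
      by simp
    then have "a * 2 ^ Suc l = b"
      by (simp only: of_int_eq_iff)
    then show False
      using h(2) by auto
  qed
  have "(THE k::nat. \<exists>r::int. odd r \<and> \<bar>x - y\<bar> = of_int r / 2 ^ k) = k"
  proof (rule the_equality)
    show "\<exists>r::int. odd r \<and> \<bar>x - y\<bar> = of_int r / 2 ^ k"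
      using assms by blast
    fix k' assume "\<exists>r::int. odd r \<and> \<bar>x - y\<bar> = of_int r / 2 ^ k'"
    then show "k' = k"
      using * assms by (metis linorder_neqE_nat)
  qed
  moreover have "x \<noteq> y"
    using assms by auto
  ultimately show ?thesis
    by (simp add: two_adic_dist_def)
qed

end

theory Submission
  imports Defs
begin

text \<open>
  A binary word \<open>w\<close> names a standard dyadic interval of the circle, and an element \<open>f\<close> of
  \<open>T\<close> is, away from finitely many points, a rule that replaces prefixes: on the interval of \<open>u\<close>
  it exchanges the leading digits \<open>u\<close> for digits \<open>v\<close>. This relation, \<open>replaces f u v\<close>, is the
  language of the whole proof; it is the tree pair picture of \<open>T\<close> without the trees. By
  \<open>long_words_replaced\<close>, all sufficiently long words are replaced by a given \<open>f\<close>, so the set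
  \<open>unreplaced f\<close> of the words that are not (the inner nodes of the smallest domain tree of \<open>f\<close>)
  is finite.

  Lower bound. The cardinality of \<open>unreplaced\<close> is subadditive (\<open>card_unreplaced_mult\<close>), hence at
  most linear in the word length for every finite generating set. A rotation by \<open>r/2^k\<close> with \<open>r\<close>
  odd moves no dyadic interval of length greater than \<open>2^-k\<close> onto a dyadic interval, so it has
  at least \<open>2^(k-1)\<close> unreplaced words.

  Upper bound. Changing the finite generating set changes word lengths by at most a constant
  factor, so it suffices to write the rotation by \<open>m/2^k\<close> with \<open>O(2^k)\<close> letters \<open>x0\<close>, \<open>x1\<close>,
  \<open>c1\<close>. Consider the partition of the circle into the \<open>N\<close> intervals \<open>0, 10, 110, \<dots>\<close>, the leaves
  of a tree that only grows to the right (a vine). Cyclic shifts of the leaves of a vine have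
  length \<open>O(N)\<close> (\<open>rotate_vine\<close>). The map that carries the leaves of the vine with \<open>2^k\<close> leaves to
  the words of length \<open>k\<close> has length \<open>O(2^k)\<close> (\<open>unfold_vine\<close>): it is composed of the maps that
  pair up neighbouring leaves of vines with \<open>2^k, 2^(k-1), \<dots>, 2\<close> leaves, each of linear length, and
  the costs form a geometric series. Conjugating a cyclic shift by this map gives the rotation.

  Generation. Composing \<open>f\<close> with an unfolded vine yields an element that replaces every leaf of
  a vine with \<open>N\<close> leaves. The images of the leaves partition the circle, so the deepest image
  has a sibling that is an image as well; both come from cyclically neighbouring leaves because
  \<open>f\<close> preserves orientation. After a cyclic shift these are the last two leaves, which can then
  be merged into one, and induction on \<open>N\<close> ends at the identity
  (\<open>generate_if_replaces_vine\<close>).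
\<close>

section \<open>Words in the elements of a group\<close>

text \<open>
  The bound \<open>n\<close> on the number of letters is an upper bound, so that \<open>expressible\<close> is monotone
  in \<open>n\<close>; the least such \<open>n\<close> is the word length.
\<close>

definition expressible :: "('a, 'b) monoid_scheme \<Rightarrow> 'a set \<Rightarrow> nat \<Rightarrow> 'a \<Rightarrow> bool" where
  "expressible G S n g \<longleftrightarrow> (\<exists>ws. length ws \<le> n \<and> set ws \<subseteq> S \<union> m_inv G ` S \<and>
     foldr (mult G) ws (one G) = g)"

lemma expressible_mono: "expressible G S m g \<Longrightarrow> m \<le> n \<Longrightarrow> expressible G S n g"
  unfolding expressible_def using order_trans by blast

lemma expressible_one: "expressible G S n \<one>\<^bsub>G\<^esub>"
  unfolding expressible_def by (intro exI[of _ "[]"]) simp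

lemma (in group) expressible_generator:
  assumes "S \<subseteq> carrier G" "s \<in> S" shows "expressible G S 1 s"
  unfolding expressible_def by (intro exI[of _ "[s]"]) (use assms in auto)

lemma (in group) letters_closed: "S \<subseteq> carrier G \<Longrightarrow> S \<union> m_inv G ` S \<subseteq> carrier G"
  by auto

lemma (in group) word_closed:
  "set ws \<subseteq> carrier G \<Longrightarrow> foldr (\<otimes>) ws \<one> \<in> carrier G"
  by (induction ws) auto

lemma (in group) word_append:
  "set us \<subseteq> carrier G \<Longrightarrow> set vs \<subseteq> carrier G \<Longrightarrow>
     foldr (\<otimes>) (us @ vs) \<one> = foldr (\<otimes>) us \<one> \<otimes> foldr (\<otimes>) vs \<one>"
  by (induction us) (auto simp: m_assoc word_closed simp del: foldr_append)

lemma (in group) word_inverse: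
  "set ws \<subseteq> carrier G \<Longrightarrow>
     inv (foldr (\<otimes>) ws \<one>) = foldr (\<otimes>) (rev (map (m_inv G) ws)) \<one>"
proof (induction ws)
  case (Cons w ws)
  then have "set (rev (map (m_inv G) ws)) \<subseteq> carrier G" by auto
  with Cons show ?case
    using word_append[of "rev (map (m_inv G) ws)" "[inv w]"]
    by (simp add: inv_mult_group word_closed del: foldr_append)
qed simp

lemma (in group) expressible_closed:
  "S \<subseteq> carrier G \<Longrightarrow> expressible G S n g \<Longrightarrow> g \<in> carrier G"
  unfolding expressible_def using word_closed letters_closed by (metis subset_trans)

lemma (in group) expressible_mult:
  assumes "S \<subseteq> carrier G" "expressible G S m g" "expressible G S n h"
  shows "expressible G S (m + n) (g \<otimes> h)"
proof -
  obtain us vs where *: "length us \<le> m" "set us \<subseteq> S \<union> m_inv G ` S" "foldr (\<otimes>) us \<one> = g"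
    "length vs \<le> n" "set vs \<subseteq> S \<union> m_inv G ` S" "foldr (\<otimes>) vs \<one> = h"
    using assms unfolding expressible_def by blast
  then have "foldr (\<otimes>) (us @ vs) \<one> = g \<otimes> h"
    using word_append letters_closed[OF assms(1)] by (metis subset_trans)
  with * show ?thesis
    unfolding expressible_def by (intro exI[of _ "us @ vs"]) (auto simp del: foldr_append)
qed

lemma (in group) expressible_inv:
  assumes "S \<subseteq> carrier G" "expressible G S n g"
  shows "expressible G S n (inv g)"
proof -
  obtain ws where *: "length ws \<le> n" "set ws \<subseteq> S \<union> m_inv G ` S" "foldr (\<otimes>) ws \<one> = g"
    using assms unfolding expressible_def by blast
  have "inv w \<in> S \<union> m_inv G ` S" if "w \<in> S \<union> m_inv G ` S" for w
    using that assms(1) by auto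
  then have "set (rev (map (m_inv G) ws)) \<subseteq> S \<union> m_inv G ` S"
    using *(2) unfolding set_rev set_map by blast
  moreover have "foldr (\<otimes>) (rev (map (m_inv G) ws)) \<one> = inv g"
    using word_inverse[of ws] *(2,3) letters_closed[OF assms(1)] by (metis subset_trans)
  ultimately show ?thesis
    unfolding expressible_def using *(1)
    by (intro exI[of _ "rev (map (m_inv G) ws)"]) simp
qed

lemma (in group) expressible_generate:
  assumes "S \<subseteq> carrier G" "expressible G S n g"
  shows "g \<in> generate G S"
proof -
  have "foldr (\<otimes>) ws \<one> \<in> generate G S" if "set ws \<subseteq> S \<union> m_inv G ` S" for ws
    using that by (induction ws) (auto intro: generate.intros)
  then show ?thesis
    using assms unfolding expressible_def by blast
qed

lemma (in group) generate_expressible: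
  assumes "S \<subseteq> carrier G" "g \<in> generate G S"
  shows "\<exists>n. expressible G S n g"
  using assms(2)
  by induction
    (use expressible_one expressible_generator[OF assms(1)] expressible_inv[OF assms(1)]
      expressible_mult[OF assms(1)] in blast)+

text \<open>
  Word lengths for two finite generating sets differ at most by a constant factor: substitute a
  word for every letter.
\<close>

lemma (in group) expressible_change_generators:
  assumes S: "S \<subseteq> carrier G" and Y: "\<And>y. y \<in> Y \<Longrightarrow> expressible G S L y"
    and g: "expressible G Y n g"
  shows "expressible G S (L * n) g"
proof -
  have "expressible G S (L * length ws) (foldr (\<otimes>) ws \<one>)"
    if "set ws \<subseteq> Y \<union> m_inv G ` Y" for ws
    using that
  proof (induction ws)
    case (Cons w ws)
    then have "expressible G S L w"
      using Y expressible_inv[OF S] by auto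
    with Cons show ?case
      using expressible_mult[OF S, of L w] by simp
  qed (simp add: expressible_one)
  with g show ?thesis
    unfolding expressible_def[of _ Y] using expressible_mono by (metis mult_le_mono2)
qed

lemma word_length_le: "expressible G S n g \<Longrightarrow> word_length G S g \<le> n"
  unfolding expressible_def word_length_def
  by (elim exE) (rule order_trans[OF Least_le], auto)

lemma expressible_word_length:
  assumes "expressible G S n g" shows "expressible G S (word_length G S g) g"
proof -
  obtain ws where "set ws \<subseteq> S \<union> m_inv G ` S \<and> foldr (mult G) ws (one G) = g"
    using assms unfolding expressible_def by blast
  then have "\<exists>n ws. length ws = n \<and> set ws \<subseteq> S \<union> m_inv G ` S \<and> foldr (mult G) ws (one G) = g"
    by blast
  from LeastI_ex[OF this] show ?thesis
    unfolding expressible_def word_length_def by (metis order_refl)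
qed

section \<open>Binary words and prefix replacement\<close>

text \<open>
  The point of the circle with binary digits \<open>w\<close> followed by those of \<open>s\<close>. The image of
  \<open>circle\<close> under \<open>point w\<close> is the standard dyadic interval named by \<open>w\<close>.
\<close>

fun point :: "bool list \<Rightarrow> real \<Rightarrow> real" where
  "point [] s = s"
| "point (b # w) s = (of_bool b + point w s) / 2"

lemma point_append: "point (u @ v) s = point u (point v s)"
  by (induction u) auto

lemma point_affine: "point w s = point w 0 + s / 2 ^ length w"
  by (induction w) (auto simp: field_simps)

lemma point_in_circle: "s \<in> circle \<Longrightarrow> point w s \<in> circle"
  by (induction w) (auto simp: circle_def)

text \<open>
  Standard dyadic intervals are nested or disjoint.
\<close>

lemma point_eq_prefix:
  assumes "point v s = point w s'" "s \<in> circle" "s' \<in> circle" "length v \<le> length w"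
  shows "\<exists>z. w = v @ z"
  using assms
proof (induction v arbitrary: w)
  case (Cons b v)
  then obtain c w' where w: "w = c # w'" by (cases w) auto
  have "point v s \<in> circle" "point w' s' \<in> circle"
    using Cons.prems point_in_circle by auto
  then have "b = c"
    using Cons.prems(1) w by (cases b; cases c) (auto simp: circle_def)
  then show ?case
    using Cons.IH[of w'] Cons.prems w by auto
qed simp

lemma point_determines_word:
  assumes "\<And>s. s \<in> circle \<Longrightarrow> point v s = point w s" shows "v = w"
proof -
  \<comment> \<open>The left end and the midpoint determine the length and the position of the interval.\<close>
  have "point v 0 = point w 0" "point v (1/2) = point w (1/2)"
    using assms by (auto simp: circle_def)
  then have "(2::real) ^ length v = 2 ^ length w"
    using point_affine[of v "1/2"] point_affine[of w "1/2"] by (simp add: field_simps)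
  then have len: "length v = length w" by simp
  then obtain z where "w = v @ z"
    using point_eq_prefix[of v 0 w 0] \<open>point v 0 = point w 0\<close> by (auto simp: circle_def)
  with len show ?thesis by simp
qed

definition replaces :: "(real \<Rightarrow> real) \<Rightarrow> bool list \<Rightarrow> bool list \<Rightarrow> bool" where
  "replaces f u v \<longleftrightarrow> (\<forall>s\<in>circle. f (point u s) = point v s)"

lemma replaces_append: "replaces f u v \<Longrightarrow> replaces f (u @ w) (v @ w)"
  by (simp add: replaces_def point_append point_in_circle)

lemma replaces_unique: "replaces f u v \<Longrightarrow> replaces f u v' \<Longrightarrow> v = v'"
  by (rule point_determines_word) (simp add: replaces_def)

text \<open>
  The step that merges two sibling intervals when their images are siblings in the same order.
\<close>

lemma replaces_halves:
  assumes "replaces f (u @ [False]) (v @ [False])" "replaces f (u @ [True]) (v @ [True])"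
  shows "replaces f u v"
  unfolding replaces_def
proof
  fix s assume s: "s \<in> circle"
  have *: "f (point u ((of_bool b + s') / 2)) = point v ((of_bool b + s') / 2)"
    if "s' \<in> circle" for b s'
    using assms that by (cases b) (auto simp: replaces_def point_append)
  show "f (point u s) = point v s"
    using *[of "2 * s" False] *[of "2 * s - 1" True] s
    by (cases "s < 1/2") (auto simp: circle_def)
qed

section \<open>Prefix replacement in \<open>T\<close>\<close>

interpretation T: group thompson_T
  by (rule group_thompson_T)

lemma carrier_T [simp]: "carrier thompson_T = thompson_T_carrier"
  by (simp add: thompson_T_def)

lemma T_mult_apply:
  "g \<in> thompson_T_carrier \<Longrightarrow> f \<in> thompson_T_carrier \<Longrightarrow> t \<in> circle \<Longrightarrow>
     (g \<otimes>\<^bsub>thompson_T\<^esub> f) t = g (f t)"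
  by (simp add: thompson_T_def BijGroup_def T_D(10) compose_def)

lemma T_closed: "f \<in> thompson_T_carrier \<Longrightarrow> t \<in> circle \<Longrightarrow> f t \<in> circle"
  using T_D(9) by blast

lemma T_inj: "f \<in> thompson_T_carrier \<Longrightarrow> t \<in> circle \<Longrightarrow> t' \<in> circle \<Longrightarrow> f t = f t' \<Longrightarrow> t = t'"
  using T_D(8) by (metis bij_betw_imp_inj_on inj_onD)

lemma T_one_apply: "t \<in> circle \<Longrightarrow> \<one>\<^bsub>thompson_T\<^esub> t = t"
  by (simp add: one_thompson_T rotation_0)

lemma T_inv_apply:
  "f \<in> thompson_T_carrier \<Longrightarrow> t \<in> circle \<Longrightarrow> (inv\<^bsub>thompson_T\<^esub> f) (f t) = t"
  using T_mult_apply[of "inv\<^bsub>thompson_T\<^esub> f" f t] T.inv_closed[of f] T.l_inv[of f] T_one_apply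
  by simp

lemma T_eqI:
  "f \<in> thompson_T_carrier \<Longrightarrow> g \<in> thompson_T_carrier \<Longrightarrow> (\<And>t. t \<in> circle \<Longrightarrow> f t = g t) \<Longrightarrow> f = g"
  by (rule extensionalityI[of _ circle]) (auto dest: T_D(1))

text \<open>
  Surjectivity forces \<open>v\<close> to be empty: a point whose digits start with the complement of \<open>v\<close>
  is not in the interval of a nonempty \<open>v\<close>.
\<close>

lemma T_replaces_all:
  assumes "f \<in> thompson_T_carrier" "replaces f [] v"
  shows "f = \<one>\<^bsub>thompson_T\<^esub>"
proof -
  define t where "t = point (map Not v) 0"
  have t: "t \<in> circle" unfolding t_def by (rule point_in_circle) (simp add: circle_def)
  then have "t \<in> f ` circle"
    using assms(1) T_D(8) by (metis bij_betw_imp_surj_on)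
  then obtain s where "s \<in> circle" "point v s = point (map Not v) 0"
    using assms(2) by (auto simp: replaces_def t_def)
  then obtain z where "map Not v = v @ z"
    using point_eq_prefix[of v s "map Not v" 0] by (auto simp: circle_def)
  then have "v = []" by (cases v) auto
  then show ?thesis
    using assms T_one_apply by (intro T_eqI) (auto simp: replaces_def T.one_closed[simplified])
qed

lemma replaces_mult:
  assumes "g \<in> thompson_T_carrier" "f \<in> thompson_T_carrier" "replaces f u v" "replaces g v w"
  shows "replaces (g \<otimes>\<^bsub>thompson_T\<^esub> f) u w"
  using assms by (simp add: replaces_def T_mult_apply point_in_circle)

lemma replaces_inv:
  "f \<in> thompson_T_carrier \<Longrightarrow> replaces f u v \<Longrightarrow> replaces (inv\<^bsub>thompson_T\<^esub> f) v u"
  unfolding replaces_def by (metis T_inv_apply point_in_circle)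

lemma replaces_one: "replaces \<one>\<^bsub>thompson_T\<^esub> u u"
  by (simp add: replaces_def T_one_apply point_in_circle)

lemma replaces_inj:
  assumes f: "f \<in> thompson_T_carrier" and "replaces f u v" "replaces f u' v"
  shows "u = u'"
  using replaces_unique replaces_inv[OF f] assms(2,3) by blast

section \<open>The generators are elements of \<open>T\<close>\<close>

lemma dyadics_divide_2: "x \<in> dyadic_rationals \<Longrightarrow> x / 2 \<in> dyadic_rationals"
  using dyadics_mult[of x "2 powi (-1)"] dyadics_powi[of "-1"]
  by (simp add: power_int_minus del: dyadics_powi)

lemma dyadics_half [simp]: "1/2 \<in> dyadic_rationals"
  using dyadics_divide_2[of 1] dyadics_of_int[of 1] by simp

lemma dyadics_numeral [simp]: "numeral n \<in> dyadic_rationals"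
  using dyadics_of_int[of "numeral n"] by simp

lemma dyadics_1 [simp]: "1 \<in> dyadic_rationals"
  using dyadics_of_int[of 1] by simp

lemma continuous_map_circle_interval:
  assumes F: "continuous_on {0..1} F" "F 0 = 0" "F 1 = 1"
    and f: "\<And>t. t \<in> circle \<Longrightarrow> f t \<in> circle \<and> f t = F t"
  shows "continuous_map circle_topology circle_topology f"
proof (rule continuous_compose_quotient_map[OF quotient_map_frac])
  have "continuous_map (top_of_set {0..1}) circle_topology (frac \<circ> F)"
    by (rule continuous_map_compose[OF _ continuous_map_frac]) (use F(1) in auto)
  moreover have "(frac \<circ> F) t = (f \<circ> frac) t" if "t \<in> {0..1}" for t
  proof (cases "t = 1")
    case True
    then show ?thesis using f[of 0] F by (simp add: circle_def)
  next
    case False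
    then have "t \<in> circle" using that by (simp add: circle_def)
    then have "frac (F t) = f t" using f[of t] frac_circle by metis
    with \<open>t \<in> circle\<close> show ?thesis by simp
  qed
  ultimately show "continuous_map (top_of_set {0..1}) circle_topology (f \<circ> frac)"
    by (rule continuous_map_eq) simp
qed

lemma locally_affine_interval:
  assumes "0 \<le> a" "b \<le> 1" "t \<in> {a<..<b}"
    and f: "\<And>s. s \<in> {a<..<b} \<Longrightarrow> f s = m * s + c" "\<And>s. s \<in> circle \<Longrightarrow> f s \<in> circle"
  shows "locally_affine_at f m t"
  unfolding locally_affine_at_def
proof (rule eventually_nhds_in_open[of "{a<..<b}", THEN eventually_mono])
  fix s assume s: "s \<in> {a<..<b}"
  then have "s \<in> circle" using assms(1,2) by (simp add: circle_def)
  moreover have "f t + m * (s - t) = f s"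
    using f(1)[OF s] f(1)[OF assms(3)] by (simp add: algebra_simps)
  ultimately show "f (frac s) = frac (f t + m * (s - t))"
    using f(2) by simp
qed (use assms in auto)

text \<open>
  The maps \<open>F\<close> and \<open>H\<close> are a homeomorphism of the closed unit interval and its inverse; they
  descend to the circle because they fix both end points. The set \<open>B\<close> only has to contain the
  breakpoints, which spares deciding which of its points are genuine ones.
\<close>

lemma increasing_in_T:
  fixes F H :: "real \<Rightarrow> real"
  assumes ext: "f \<in> extensional circle" and f: "\<And>t. t \<in> circle \<Longrightarrow> f t = F t"
    and F: "continuous_on {0..1} F" "F 0 = 0" "F 1 = 1" "strict_mono_on {0..1} F"
    and H: "continuous_on {0..1} H" "\<And>t. t \<in> {0..1} \<Longrightarrow> H (F t) = t"
      "\<And>t. t \<in> {0..1} \<Longrightarrow> H t \<in> {0..1} \<and> F (H t) = t"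
    and B: "finite B" "B \<subseteq> dyadic_rationals"
      "\<And>s. s \<in> circle \<Longrightarrow> s \<notin> B \<Longrightarrow> \<exists>k::int. locally_affine_at f (2 powi k) s"
    and dy: "\<And>t. t \<in> dyadic_rationals \<Longrightarrow> F t \<in> dyadic_rationals"
  shows "f \<in> thompson_T_carrier"
proof -
  have less: "F s < F t" if "0 \<le> s" "s < t" "t \<le> 1" for s t
    using F(4) that by (auto simp: strict_mono_on_def)
  have Fc: "F t \<in> circle" if "t \<in> circle" for t
    using that less[of 0 t] less[of t 1] F by (cases "t = 0") (auto simp: circle_def)
  have Hc: "H t \<in> circle" if "t \<in> circle" for t
  proof -
    have "H t \<noteq> 1" using H(3)[of t] F(3) that by (auto simp: circle_def)
    then show ?thesis using H(3)[of t] that by (auto simp: circle_def)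
  qed
  have H01: "H 0 = 0" "H 1 = 1"
    using H(2)[of 0] H(2)[of 1] F by auto
  have "homeomorphic_maps circle_topology circle_topology f H"
    unfolding homeomorphic_maps_def
  proof (intro conjI ballI)
    show "continuous_map circle_topology circle_topology f"
      by (rule continuous_map_circle_interval[OF F(1-3)]) (simp add: f Fc)
    show "continuous_map circle_topology circle_topology H"
      by (rule continuous_map_circle_interval[OF H(1) H01]) (simp add: Hc)
  qed (use f Fc Hc H in \<open>auto simp: circle_def\<close>)
  then have "homeomorphic_map circle_topology circle_topology f"
    using homeomorphic_map_maps by blast
  moreover have "orientation_preserving f"
  proof -
    have "f s < f t" if "s \<in> circle" "t \<in> circle" "s < t" for s t
      using that less f by (auto simp: circle_def)
    then show ?thesis
      unfolding orientation_preserving_def cyclic_order_def by blast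
  qed
  moreover have bp: "breakpoints f \<subseteq> B"
    using B(3) unfolding breakpoints_def by blast
  moreover have "\<exists>k::int. m = 2 powi k" if "t \<in> circle" "locally_affine_at f m t" for t m
    using slope_powi_2[OF B(1) B(3)] that by blast
  moreover have "f ` (dyadic_rationals \<inter> circle) \<subseteq> dyadic_rationals"
    using f dy by auto
  ultimately show ?thesis
    unfolding thompson_T_carrier_def using ext B finite_subset by blast
qed

lemma dyadics_max: "x \<in> dyadic_rationals \<Longrightarrow> y \<in> dyadic_rationals \<Longrightarrow> max x y \<in> dyadic_rationals"
  by (simp add: max_def)

lemma dyadics_min: "x \<in> dyadic_rationals \<Longrightarrow> y \<in> dyadic_rationals \<Longrightarrow> min x y \<in> dyadic_rationals"
  by (simp add: min_def)

lemma x0_in_T: "x0 \<in> thompson_T_carrier"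
proof (rule increasing_in_T)
  \<comment> \<open>As maxima and minima of affine functions, \<open>F\<close> and \<open>H\<close> are visibly continuous. In \<open>F\<close> the constant
    \<open>1/4\<close> is written \<open>1/2/2\<close> to make it visibly dyadic.\<close>
  define F :: "real \<Rightarrow> real" where "F = (\<lambda>t. max (t / 2) (max (t - 1/2/2) (2 * t - 1)))"
  define H :: "real \<Rightarrow> real" where "H = (\<lambda>t. min (2 * t) (min (t + 1/4) ((t + 1) / 2)))"
  show "x0 \<in> extensional circle" by (simp add: x0_def)
  show x0: "x0 t = F t" if "t \<in> circle" for t
    using that by (auto simp: x0_def F_def circle_def max_def)
  show "continuous_on {0..1} F" "continuous_on {0..1} H"
    unfolding F_def H_def by (intro continuous_intros; simp)+
  show "F 0 = 0" "F 1 = 1" "strict_mono_on {0..1} F"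
    by (auto simp: F_def strict_mono_on_def max_def min_def)
  show "H (F t) = t" if "t \<in> {0..1}" for t
    using that by (auto simp: F_def H_def max_def min_def; linarith)
  show "H t \<in> {0..1} \<and> F (H t) = t" if "t \<in> {0..1}" for t
    using that unfolding F_def H_def max_def min_def atLeastAtMost_iff by argo
  show "F t \<in> dyadic_rationals" if "t \<in> dyadic_rationals" for t
    unfolding F_def using that
    by (intro dyadics_max dyadics_diff dyadics_mult dyadics_divide_2) auto
  show "finite {0, 1/2, 3/4::real}" "{0, 1/2, 3/4::real} \<subseteq> dyadic_rationals"
    using dyadics_divide_2[OF dyadics_divide_2, of 3] by auto
  have c: "x0 t \<in> circle" if "t \<in> circle" for t
    using that by (auto simp: x0_def circle_def)
  show "\<exists>k::int. locally_affine_at x0 (2 powi k) s" if s: "s \<in> circle" "s \<notin> {0, 1/2, 3/4}" for s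
  proof -
    consider "s \<in> {0<..<1/2}" | "s \<in> {1/2<..<3/4}" | "s \<in> {3/4<..<1}"
      using s by (force simp: circle_def)
    then show ?thesis
    proof cases
      case 1
      have "locally_affine_at x0 (2 powi (-1)) s"
        by (rule locally_affine_interval[of 0 "1/2" _ _ _ 0])
          (use 1 c in \<open>auto simp: x0_def circle_def\<close>)
      then show ?thesis by blast
    next
      case 2
      have "locally_affine_at x0 (2 powi 0) s"
        by (rule locally_affine_interval[of "1/2" "3/4" _ _ _ "-1/4"])
          (use 2 c in \<open>auto simp: x0_def circle_def\<close>)
      then show ?thesis by blast
    next
      case 3
      have "locally_affine_at x0 (2 powi 1) s"
        by (rule locally_affine_interval[of "3/4" 1 _ _ _ "-1"])
          (use 3 c in \<open>auto simp: x0_def circle_def\<close>)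
      then show ?thesis by blast
    qed
  qed
qed

lemma x1_eq:
  "t \<in> circle \<Longrightarrow> x1 t = (if t < 1/2 then t else if t < 3/4 then t / 2 + 1/4
     else if t < 7/8 then t - 1/8 else 2 * t - 1)"
  by (auto simp: x1_def x0_def circle_def field_simps)

lemma x1_in_T: "x1 \<in> thompson_T_carrier"
proof (rule increasing_in_T)
  define F :: "real \<Rightarrow> real"
    where "F = (\<lambda>t. min t (max (t / 2 + 1/2/2) (max (t - 1/2/2/2) (2 * t - 1))))"
  define H :: "real \<Rightarrow> real"
    where "H = (\<lambda>t. max t (min (2 * t - 1/2) (min (t + 1/8) ((t + 1) / 2))))"
  show "x1 \<in> extensional circle" by (simp add: x1_def)
  show "x1 t = F t" if "t \<in> circle" for t
    using that unfolding x1_eq[OF that] by (auto simp: F_def circle_def max_def min_def)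
  show "continuous_on {0..1} F" "continuous_on {0..1} H"
    unfolding F_def H_def by (intro continuous_intros; simp)+
  show "F 0 = 0" "F 1 = 1" "strict_mono_on {0..1} F"
    by (auto simp: F_def strict_mono_on_def max_def min_def)
  show "H (F t) = t" if "t \<in> {0..1}" for t
    using that by (auto simp: F_def H_def max_def min_def; linarith)
  show "H t \<in> {0..1} \<and> F (H t) = t" if "t \<in> {0..1}" for t
    using that unfolding F_def H_def max_def min_def atLeastAtMost_iff by argo
  show "F t \<in> dyadic_rationals" if "t \<in> dyadic_rationals" for t
    unfolding F_def using that
    by (intro dyadics_max dyadics_min dyadics_diff dyadics_add dyadics_mult dyadics_divide_2) auto
  show "finite {0, 1/2, 3/4, 7/8::real}" "{0, 1/2, 3/4, 7/8::real} \<subseteq> dyadic_rationals"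
    using dyadics_divide_2[OF dyadics_divide_2, of 3]
      dyadics_divide_2[OF dyadics_divide_2[OF dyadics_divide_2], of 7] by auto
  have c: "x1 t \<in> circle" if "t \<in> circle" for t
    using that unfolding x1_eq[OF that] by (auto simp: circle_def)
  show "\<exists>k::int. locally_affine_at x1 (2 powi k) s"
    if s: "s \<in> circle" "s \<notin> {0, 1/2, 3/4, 7/8}" for s
  proof -
    consider "s \<in> {0<..<1/2}" | "s \<in> {1/2<..<3/4}" | "s \<in> {3/4<..<7/8}" | "s \<in> {7/8<..<1}"
      using s by (force simp: circle_def)
    then show ?thesis
    proof cases
      case 1
      have "locally_affine_at x1 (2 powi 0) s"
        by (rule locally_affine_interval[of 0 "1/2" _ _ _ 0])
          (use 1 c in \<open>auto simp: x1_eq circle_def\<close>)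
      then show ?thesis by blast
    next
      case 2
      have "locally_affine_at x1 (2 powi (-1)) s"
        by (rule locally_affine_interval[of "1/2" "3/4" _ _ _ "1/4"])
          (use 2 c in \<open>auto simp: x1_eq circle_def\<close>)
      then show ?thesis by blast
    next
      case 3
      have "locally_affine_at x1 (2 powi 0) s"
        by (rule locally_affine_interval[of "3/4" "7/8" _ _ _ "-1/8"])
          (use 3 c in \<open>auto simp: x1_eq circle_def\<close>)
      then show ?thesis by blast
    next
      case 4
      have "locally_affine_at x1 (2 powi 1) s"
        by (rule locally_affine_interval[of "7/8" 1 _ _ _ "-1"])
          (use 4 c in \<open>auto simp: x1_eq circle_def\<close>)
      then show ?thesis by blast
    qed
  qed
qed

section \<open>The generators as prefix replacements\<close>

lemma replaces_x0:
  "replaces x0 (False # w) (False # False # w)"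
  "replaces x0 (True # False # w) (False # True # w)"
  "replaces x0 (True # True # w) (True # w)"
proof -
  have "replaces x0 [False] [False, False]" "replaces x0 [True, False] [False, True]"
    "replaces x0 [True, True] [True]"
    by (auto simp: replaces_def x0_def circle_def field_simps)
  from this[THEN replaces_append, of w] show
    "replaces x0 (False # w) (False # False # w)"
    "replaces x0 (True # False # w) (False # True # w)"
    "replaces x0 (True # True # w) (True # w)" by simp_all
qed

lemma replaces_x1:
  "replaces x1 (False # w) (False # w)"
  "replaces x1 (True # False # w) (True # False # False # w)"
  "replaces x1 (True # True # False # w) (True # False # True # w)"
  "replaces x1 (True # True # True # w) (True # True # w)"
proof -
  have "replaces x1 [False] [False]" "replaces x1 [True, False] [True, False, False]"
    "replaces x1 [True, True, False] [True, False, True]"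
    "replaces x1 [True, True, True] [True, True]"
    by (auto simp: replaces_def x1_def x0_def circle_def field_simps)
  from this[THEN replaces_append, of w] show
    "replaces x1 (False # w) (False # w)"
    "replaces x1 (True # False # w) (True # False # False # w)"
    "replaces x1 (True # True # False # w) (True # False # True # w)"
    "replaces x1 (True # True # True # w) (True # True # w)" by simp_all
qed

abbreviation half_turn :: "real \<Rightarrow> real" where
  "half_turn \<equiv> rotation (1/2)"

lemma half_turn_in_T: "half_turn \<in> thompson_T_carrier"
  by (simp add: rotation_in_T)

lemma half_turn_eq: "t \<in> circle \<Longrightarrow> half_turn t = (if t < 1/2 then t + 1/2 else t - 1/2)"
  by (auto simp: rotation_def circle_def frac_unique_iff)

lemma replaces_half_turn: "replaces half_turn (b # w) ((\<not> b) # w)"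
proof -
  have "half_turn (point [b] s) = point [\<not> b] s" if "s \<in> circle" for s
    using that half_turn_eq[OF point_in_circle[OF that, of "[b]"]]
    by (cases b) (auto simp: circle_def field_simps)
  then have "replaces half_turn [b] [\<not> b]"
    by (simp add: replaces_def)
  from replaces_append[OF this, of w] show ?thesis by simp
qed

text \<open>
  The membership of \<open>c1\<close> in \<open>T\<close> is inherited from \<open>x0\<close> and the rotations.
\<close>

lemma c1_eq: "c1 = inv\<^bsub>thompson_T\<^esub> x0 \<otimes>\<^bsub>thompson_T\<^esub> half_turn"
  and c1_in_T: "c1 \<in> thompson_T_carrier"
proof -
  define c where "c = inv\<^bsub>thompson_T\<^esub> x0 \<otimes>\<^bsub>thompson_T\<^esub> half_turn"
  have inv: "inv\<^bsub>thompson_T\<^esub> x0 \<in> thompson_T_carrier"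
    using T.inv_closed[of x0] x0_in_T by simp
  have c: "c \<in> thompson_T_carrier"
    unfolding c_def using T.m_closed[of "inv\<^bsub>thompson_T\<^esub> x0" half_turn] inv half_turn_in_T by simp
  have "c1 t = c t" if t: "t \<in> circle" for t
  proof -
    have c1t: "c1 t \<in> circle" "x0 (c1 t) = half_turn t"
      using t by (auto simp: c1_def x0_def half_turn_eq circle_def)
    have "c t = (inv\<^bsub>thompson_T\<^esub> x0) (x0 (c1 t))"
      using c1t t inv half_turn_in_T by (simp add: c_def T_mult_apply)
    then show ?thesis
      using T_inv_apply[OF x0_in_T c1t(1)] by simp
  qed
  moreover have "c1 \<in> extensional circle" by (simp add: c1_def)
  ultimately have "c1 = c"
    using T_D(1)[OF c] by (intro extensionalityI[of _ circle]) auto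
  then show "c1 = inv\<^bsub>thompson_T\<^esub> x0 \<otimes>\<^bsub>thompson_T\<^esub> half_turn" "c1 \<in> thompson_T_carrier"
    using c by (simp_all add: c_def)
qed

section \<open>Rotations as short products of generators\<close>

abbreviation gens :: "(real \<Rightarrow> real) set" where
  "gens \<equiv> {x0, x1, c1}"

lemma gens_in_T: "gens \<subseteq> thompson_T_carrier"
  by (simp add: x0_in_T x1_in_T c1_in_T)

abbreviation short :: "nat \<Rightarrow> (real \<Rightarrow> real) \<Rightarrow> bool" where
  "short \<equiv> expressible thompson_T gens"

lemma short_in_T: "short n g \<Longrightarrow> g \<in> thompson_T_carrier"
  using T.expressible_closed[of gens n g] gens_in_T by simp

lemma short_mult: "short m g \<Longrightarrow> short n h \<Longrightarrow> short (m + n) (g \<otimes>\<^bsub>thompson_T\<^esub> h)"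
  using T.expressible_mult[of gens] gens_in_T by simp

lemma short_inv: "short n g \<Longrightarrow> short n (inv\<^bsub>thompson_T\<^esub> g)"
  using T.expressible_inv[of gens] gens_in_T by simp

lemma short_x0: "short 1 x0" and short_x1: "short 1 x1" and short_c1: "short 1 c1"
  using T.expressible_generator[of gens] gens_in_T by simp_all

lemma short_half_turn: "short 2 half_turn"
proof -
  have "x0 \<otimes>\<^bsub>thompson_T\<^esub> c1 = half_turn"
    using x0_in_T half_turn_in_T T.inv_closed[of x0] by (simp add: c1_eq T.m_assoc[symmetric] T.r_inv)
  then show ?thesis
    using short_mult[OF short_x0 short_c1] by (simp add: numeral_2_eq_2)
qed

text \<open>
  This is \<open>x0\<close> acting on the left half of the circle, as \<open>x1\<close> is \<open>x0\<close> acting on the right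
  half.
\<close>

abbreviation left_x0 :: "real \<Rightarrow> real" where
  "left_x0 \<equiv> half_turn \<otimes>\<^bsub>thompson_T\<^esub> (x1 \<otimes>\<^bsub>thompson_T\<^esub> half_turn)"

lemma short_left_x0: "short 5 left_x0"
  using short_mult[OF short_half_turn short_mult[OF short_x1 short_half_turn]] by simp

lemma short_replaces_mult:
  assumes "short m g" "short n f" "replaces f u v" "replaces g v w"
  shows "replaces (g \<otimes>\<^bsub>thompson_T\<^esub> f) u w"
  using replaces_mult[OF short_in_T short_in_T] assms by blast

lemma short_replaces_inv:
  assumes "short n f" "replaces f u v"
  shows "replaces (inv\<^bsub>thompson_T\<^esub> f) v u"
  using replaces_inv[OF short_in_T] assms by blast

lemma replaces_left_x0:
  "replaces left_x0 (False # False # w) (False # False # False # w)"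
  "replaces left_x0 (False # True # False # w) (False # False # True # w)"
  "replaces left_x0 (False # True # True # w) (False # True # w)"
  "replaces left_x0 (True # w) (True # w)"
proof -
  have *: "replaces left_x0 (b # u) (b # v)" if "replaces x1 ((\<not> b) # u) ((\<not> b) # v)" for b u v
    using short_replaces_mult[OF short_half_turn short_mult[OF short_x1 short_half_turn]
        short_replaces_mult[OF short_x1 short_half_turn replaces_half_turn that]
        replaces_half_turn] by simp
  show "replaces left_x0 (False # False # w) (False # False # False # w)"
    "replaces left_x0 (False # True # False # w) (False # False # True # w)"
    "replaces left_x0 (False # True # True # w) (False # True # w)"
    "replaces left_x0 (True # w) (True # w)"
    by (rule *; simp add: replaces_x1)+
qed

text \<open>
  The leaves, from left to right, of the tree with \<open>N\<close> leaves that only branches to the right: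
  \<open>0, 10, 110, \<dots>\<close>. The last leaf consists of digits 1 only and, for \<open>N \<ge> 2\<close>, is as
  long as the last but one.
\<close>

definition vine_leaf :: "nat \<Rightarrow> nat \<Rightarrow> bool list" where
  "vine_leaf N i = replicate i True @ (if Suc i < N then [False] else [])"

lemma vine_leaf_Suc [simp]: "vine_leaf (Suc N) (Suc i) = True # vine_leaf N i"
  by (simp add: vine_leaf_def)

lemma vine_leaf_0: "vine_leaf N 0 = (if N \<le> 1 then [] else [False])"
  by (simp add: vine_leaf_def)

lemma replicate_vine_leaf: "replicate m True @ vine_leaf N i = vine_leaf (m + N) (m + i)"
  by (induction m) auto

text \<open>
  Shifting one leaf more to the left costs a constant number of letters: if \<open>f\<close> moves the first
  \<open>a\<close> leaves of the vine with \<open>a + 1\<close> leaves under the digit 0 as a vine, then the inverse of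
  \<open>left_x0\<close> times \<open>f\<close> times \<open>x0\<close> does so for \<open>a + 1\<close>. Here \<open>x0\<close> joins the first two leaves
  under a common parent, \<open>f\<close> carries that parent to the word \<open>00\<close>, and the inverse of \<open>left_x0\<close>
  restores the shape of a vine below the digit 0.
\<close>

lemma fold_vine:
  assumes "a \<ge> 1"
  shows "\<exists>f. short (6 * a) f \<and> (\<forall>i<a. replaces f (replicate i True @ [False]) (False # vine_leaf a i)) \<and>
     replaces f (replicate a True) [True]"
  using assms
proof (induction a rule: nat_induct_at_least)
  case base
  then show ?case
    using replaces_one by (intro exI[of _ "\<one>\<^bsub>thompson_T\<^esub>"])
      (simp add: expressible_one vine_leaf_0)
next
  case (Suc a)
  then obtain f where f: "short (6 * a) f"
    "\<And>i. i < a \<Longrightarrow> replaces f (replicate i True @ [False]) (False # vine_leaf a i)"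
    "replaces f (replicate a True) [True]"
    by blast
  show ?case
  proof (cases "a = 1")
    case True
    have "replaces x0 (replicate i True @ [False]) (False # vine_leaf 2 i)" if "i < 2" for i
    proof -
      consider "i = 0" | "i = 1" using \<open>i < 2\<close> by linarith
      then show ?thesis
        using replaces_x0[of "[]"] by cases (auto simp: vine_leaf_def)
    qed
    then show ?thesis
      using replaces_x0(3)[of "[]"] True expressible_mono[OF short_x0, of 12]
      by (intro exI[of _ x0]) (simp add: numeral_2_eq_2)
  next
    case False
    \<comment> \<open>The two base cases are the identity for one leaf and \<open>x0\<close> for two; the recursion needs
      that \<open>f\<close> sends 0 to 00, which holds from \<open>a = 2\<close> on.\<close>
    define g where "g = f \<otimes>\<^bsub>thompson_T\<^esub> x0"
    define h where "h = inv\<^bsub>thompson_T\<^esub> left_x0 \<otimes>\<^bsub>thompson_T\<^esub> g"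
    have sg: "short (6 * a + 1) g"
      unfolding g_def by (rule short_mult[OF f(1) short_x0])
    have "short (5 + (6 * a + 1)) h"
      unfolding h_def by (rule short_mult[OF short_inv[OF short_left_x0] sg])
    then have "short (6 * Suc a) h" by simp
    moreover have h: "replaces h u v"
      if "replaces x0 u w" "replaces f w w'" "replaces left_x0 v w'" for u w w' v
      unfolding h_def
      using short_replaces_mult[OF short_inv[OF short_left_x0] sg
          _ short_replaces_inv[OF short_left_x0 that(3)]]
        short_replaces_mult[OF f(1) short_x0 that(1,2)] g_def by blast
    have "replaces h (replicate i True @ [False]) (False # vine_leaf (Suc a) i)" if "i < Suc a" for i
    proof -
      consider "i = 0" | "i = 1" | j where "i = Suc (Suc j)" by (cases i; cases "i - 1") auto
      then show ?thesis
      proof cases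
        case 1
        have "replaces f [False, False] [False, False, False]"
          using replaces_append[OF f(2)[of 0], of "[False]"] False Suc by (simp add: vine_leaf_0)
        then have "replaces h [False] [False, False]"
          using h replaces_x0(1)[of "[]"] replaces_left_x0(1)[of "[]"] by blast
        then show ?thesis using 1 Suc by (simp add: vine_leaf_0)
      next
        case 2
        have "replaces f [False, True] [False, False, True]"
          using replaces_append[OF f(2)[of 0], of "[True]"] False Suc by (simp add: vine_leaf_0)
        then have "replaces h [True, False] [False, True, False]"
          using h replaces_x0(2)[of "[]"] replaces_left_x0(2)[of "[]"] by blast
        then show ?thesis using 2 Suc False by (simp add: vine_leaf_def)
      next
        case 3
        obtain a' where a': "a = Suc a'" using Suc by (cases a) auto
        have "replaces h (True # True # replicate j True @ [False]) (False # True # True # vine_leaf a' j)"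
          using h[OF replaces_x0(3) _ replaces_left_x0(3)] f(2)[of "Suc j"] that 3 a' by simp
        then show ?thesis using 3 a' by simp
      qed
    qed
    moreover have "replaces h (replicate (Suc a) True) [True]"
      using h[OF _ f(3), of "replicate (Suc a) True" "[True]"] replaces_left_x0(4)[of "[]"]
        replaces_x0(3) Suc by (cases a) auto
    ultimately show ?thesis by blast
  qed
qed

text \<open>
  Let \<open>a + b = N\<close>, where \<open>b\<close> is the number of leaves that wrap around. Folding the first \<open>a\<close>
  leaves into the left half leaves a vine with \<open>a\<close> leaves in the left and one with \<open>b\<close> leaves
  in the right half; a half turn exchanges the two, and unfolding with \<open>b\<close> in place of \<open>a\<close> puts
  the former right half in front.
\<close>

lemma rotate_vine:
  assumes "N \<ge> 1"
  shows "\<exists>f. short (8 * N) f \<and> (\<forall>i<N. replaces f (vine_leaf N i) (vine_leaf N ((i + m) mod N)))"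
proof (cases "m mod N = 0")
  case True
  have id: "(i + m) mod N = i" if "i < N" for i
    using that True mod_add_right_eq[of i m N] by simp
  show ?thesis
  proof (intro exI[of _ "\<one>\<^bsub>thompson_T\<^esub>"] conjI allI impI)
    show "replaces \<one>\<^bsub>thompson_T\<^esub> (vine_leaf N i) (vine_leaf N ((i + m) mod N))"
      if "i < N" for i
      unfolding id[OF that] by (rule replaces_one)
  qed (rule expressible_one)
next
  case False
  define b where "b = m mod N"
  define a where "a = N - b"
  have ab: "a \<ge> 1" "b \<ge> 1" "a + b = N"
    using False assms mod_less_divisor[of N m] unfolding a_def b_def by linarith+
  obtain f where f: "short (6 * a) f"
    "\<And>i. i < a \<Longrightarrow> replaces f (replicate i True @ [False]) (False # vine_leaf a i)"
    "replaces f (replicate a True) [True]"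
    using fold_vine[OF ab(1)] by blast
  obtain g where g: "short (6 * b) g"
    "\<And>i. i < b \<Longrightarrow> replaces g (replicate i True @ [False]) (False # vine_leaf b i)"
    "replaces g (replicate b True) [True]"
    using fold_vine[OF ab(2)] by blast
  define h where "h = half_turn \<otimes>\<^bsub>thompson_T\<^esub> f"
  define k where "k = inv\<^bsub>thompson_T\<^esub> g \<otimes>\<^bsub>thompson_T\<^esub> h"
  have sh: "short (2 + 6 * a) h"
    unfolding h_def by (rule short_mult[OF short_half_turn f(1)])
  have "short (6 * b + (2 + 6 * a)) k"
    unfolding k_def by (rule short_mult[OF short_inv[OF g(1)] sh])
  moreover have "6 * b + (2 + 6 * a) \<le> 8 * N" using ab by linarith
  ultimately have "short (8 * N) k" by (rule expressible_mono)
  moreover have k: "replaces k u v" if "replaces f u (c # w)" "replaces g v ((\<not> c) # w)" for u v w c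
  proof -
    have "replaces h u ((\<not> c) # w)"
      unfolding h_def by (rule short_replaces_mult[OF short_half_turn f(1) that(1) replaces_half_turn])
    then show ?thesis
      unfolding k_def
      by (rule short_replaces_mult[OF short_inv[OF g(1)] sh _ short_replaces_inv[OF g(1) that(2)]])
  qed
  have "replaces k (vine_leaf N i) (vine_leaf N ((i + m) mod N))" if i: "i < N" for i
  proof (cases "i < a")
    case True
    have eq: "(i + m) mod N = b + i"
      using True ab mod_add_right_eq[of i m N] by (simp add: b_def add.commute)
    have "replaces g (vine_leaf N (b + i)) (True # vine_leaf a i)"
      using replaces_append[OF g(3), of "vine_leaf a i"] ab
      by (simp add: replicate_vine_leaf add.commute)
    moreover have "replaces f (vine_leaf N i) (False # vine_leaf a i)"
      using f(2)[OF True] True ab by (simp add: vine_leaf_def)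
    ultimately show ?thesis using k[of _ False] eq by simp
  next
    case False
    define j where "j = i - a"
    have j: "i = a + j" "j < b" using False i ab by (auto simp: j_def)
    have eq: "(i + m) mod N = j"
    proof -
      have "(i + m) mod N = (i + b) mod N" by (simp add: b_def mod_add_right_eq)
      also have "i + b = j + N" using j ab by simp
      finally show ?thesis using j ab by simp
    qed
    have "replaces f (vine_leaf N i) (True # vine_leaf b j)"
      using replaces_append[OF f(3), of "vine_leaf b j"] ab j
      by (simp add: replicate_vine_leaf)
    moreover have "replaces g (vine_leaf N j) (False # vine_leaf b j)"
      using g(2)[OF j(2)] j ab by (simp add: vine_leaf_def)
    ultimately show ?thesis using k[of _ True] eq by simp
  qed
  ultimately show ?thesis by blast
qed

text \<open>
  The map that joins the leaves \<open>2 i\<close> and \<open>2 i + 1\<close> of a long vine under the leaf \<open>i\<close> of a vine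
  of half the length. For two pairs it is \<open>x0\<close>. One more pair costs three letters: \<open>x0\<close> and
  \<open>x1\<close> join the first two pairs of leaves into the words 0 and 10, \<open>f\<close> joins these two words as
  its own first pair and the later leaves as required, and the inverse of \<open>x0\<close> separates the
  words 00 and 01 into 0 and 10.
\<close>

lemma pair_vine:
  assumes "N \<ge> 1"
  shows "\<exists>f. short (3 * N) f \<and>
     (\<forall>i<N. \<forall>b. replaces f (vine_leaf (2 * N) (2 * i + of_bool b)) (vine_leaf N i @ [b]))"
  using assms
proof (induction N rule: nat_induct_at_least)
  case base
  have "replaces \<one>\<^bsub>thompson_T\<^esub> (vine_leaf 2 (of_bool b)) (vine_leaf 1 0 @ [b])" for b
    using replaces_one by (cases b) (auto simp: vine_leaf_def)
  then show ?case
    by (intro exI[of _ "\<one>\<^bsub>thompson_T\<^esub>"]) (simp add: expressible_one)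
next
  case (Suc N)
  then obtain f where f: "short (3 * N) f"
    "\<And>i b. i < N \<Longrightarrow> replaces f (vine_leaf (2 * N) (2 * i + of_bool b)) (vine_leaf N i @ [b])"
    by blast
  show ?case
  proof (cases "N = 1")
    case True
    have "replaces x0 (vine_leaf 4 (2 * i + of_bool b)) (vine_leaf 2 i @ [b])" if "i < 2" for i b
    proof -
      consider "i = 0" | "i = 1" using \<open>i < 2\<close> by linarith
      then show ?thesis
        using replaces_x0[of "[]"] replaces_x0[of "[False]"] replaces_x0[of "[True]"]
        by cases (cases b; simp add: vine_leaf_def numeral_eq_Suc)+
    qed
    then show ?thesis
      using True expressible_mono[OF short_x0, of 6]
      by (intro exI[of _ x0]) (simp add: numeral_2_eq_2[symmetric])
  next
    case False
    then obtain M where M: "N = Suc (Suc M)"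
      using Suc by (cases N; cases "N - 1") auto
    define g where "g = f \<otimes>\<^bsub>thompson_T\<^esub> (x1 \<otimes>\<^bsub>thompson_T\<^esub> x0)"
    define h where "h = inv\<^bsub>thompson_T\<^esub> x0 \<otimes>\<^bsub>thompson_T\<^esub> g"
    have s10: "short (1 + 1) (x1 \<otimes>\<^bsub>thompson_T\<^esub> x0)"
      by (rule short_mult[OF short_x1 short_x0])
    have sg: "short (3 * N + (1 + 1)) g"
      unfolding g_def by (rule short_mult[OF f(1) s10])
    have "short (1 + (3 * N + (1 + 1))) h"
      unfolding h_def by (rule short_mult[OF short_inv[OF short_x0] sg])
    then have "short (3 * Suc N) h" by (rule expressible_mono) simp
    moreover have h: "replaces h u v"
      if "replaces x0 u w" "replaces x1 w w'" "replaces f w' w''" "replaces x0 v w''" for u w w' w'' v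
      unfolding h_def
      using short_replaces_mult[OF short_inv[OF short_x0] sg
          _ short_replaces_inv[OF short_x0 that(4)]]
        short_replaces_mult[OF f(1) s10 short_replaces_mult[OF short_x1 short_x0 that(1,2)] that(3)]
        g_def by blast
    have f0: "replaces f (False # w) (False # False # w)" for w
      using replaces_append[OF f(2)[of 0 False], of w] M by (simp add: vine_leaf_def)
    have f1: "replaces f (True # False # w) (False # True # w)" for w
      using replaces_append[OF f(2)[of 0 True], of w] M by (simp add: vine_leaf_def)
    have "replaces h (vine_leaf (2 * Suc N) (2 * i + of_bool b)) (vine_leaf (Suc N) i @ [b])"
      if "i < Suc N" for i b
    proof -
      consider "i = 0" | "i = 1" | j where "i = Suc (Suc j)" by (cases i; cases "i - 1") auto
      then show ?thesis
      proof cases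
        case 1
        then show ?thesis
          using h[OF replaces_x0(1)[of "[]"] replaces_x1(1) f0 replaces_x0(1)]
            h[OF replaces_x0(2)[of "[]"] replaces_x1(1) f0 replaces_x0(1)] M
          by (cases b) (simp_all add: vine_leaf_def)
      next
        case 2
        then show ?thesis
          using h[OF replaces_x0(3)[of "[False]"] replaces_x1(2) f1 replaces_x0(2)]
            h[OF replaces_x0(3)[of "[True, False]"] replaces_x1(3) f1 replaces_x0(2)] M
          by (cases b) (simp_all add: vine_leaf_def numeral_eq_Suc)
      next
        case 3
        have "replaces f (True # True # vine_leaf (2 * Suc M) (2 * j + of_bool b))
            (True # vine_leaf (Suc M) j @ [b])"
          using f(2)[of "Suc j" b] that 3 M by simp
        then have "replaces h (True # True # True # True # vine_leaf (2 * Suc M) (2 * j + of_bool b))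
            (True # True # vine_leaf (Suc M) j @ [b])"
          using h[OF replaces_x0(3) replaces_x1(4) _ replaces_x0(3)] by blast
        then show ?thesis using 3 M by simp
      qed
    qed
    ultimately show ?thesis by blast
  qed
qed

fun binary_word :: "nat \<Rightarrow> nat \<Rightarrow> bool list" where
  "binary_word 0 i = []"
| "binary_word (Suc k) i = binary_word k (i div 2) @ [odd i]"

lemma length_binary_word [simp]: "length (binary_word k i) = k"
  by (induction k arbitrary: i) auto

text \<open>
  Thus \<open>binary_word k i\<close> names the \<open>i\<close>-th interval, from the left, of length \<open>1/2^k\<close>.
\<close>

lemma point_binary_word: "i < 2 ^ k \<Longrightarrow> point (binary_word k i) s = (real i + s) / 2 ^ k"
proof (induction k arbitrary: i s)
  case (Suc k)
  have "real i = 2 * real (i div 2) + of_bool (odd i)"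
    by (cases "even i") (auto elim!: evenE oddE)
  moreover have "i div 2 < 2 ^ k" using Suc.prems by auto
  ultimately show ?case
    using Suc.IH[of "i div 2"] by (simp add: point_append field_simps)
qed simp

text \<open>
  Pairing the leaves of the vine with \<open>2^k\<close> leaves produces the vine with \<open>2^(k-1)\<close> leaves and
  one binary digit below each leaf, and the recursion unfolds the latter. The numbers of letters
  add up to \<open>3 * 2^(k-1) + 3 * 2^(k-2) + \<dots>\<close>, which is why the total stays linear in \<open>2^k\<close>.
\<close>

lemma unfold_vine:
  "\<exists>f. short (3 * 2 ^ k) f \<and> (\<forall>i<2 ^ k. replaces f (vine_leaf (2 ^ k) i) (binary_word k i))"
proof (induction k)
  case 0
  then show ?case
    using replaces_one by (intro exI[of _ "\<one>\<^bsub>thompson_T\<^esub>"]) (simp add: expressible_one vine_leaf_def)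
next
  case (Suc k)
  then obtain f where f: "short (3 * 2 ^ k) f"
    "\<And>i. i < 2 ^ k \<Longrightarrow> replaces f (vine_leaf (2 ^ k) i) (binary_word k i)" by blast
  obtain g where g: "short (3 * 2 ^ k) g"
    "\<And>i b. i < 2 ^ k \<Longrightarrow>
       replaces g (vine_leaf (2 * 2 ^ k) (2 * i + of_bool b)) (vine_leaf (2 ^ k) i @ [b])"
    using pair_vine[of "2 ^ k"] by auto
  have "short (3 * 2 ^ Suc k) (f \<otimes>\<^bsub>thompson_T\<^esub> g)"
    using short_mult[OF f(1) g(1)] by simp
  moreover have "replaces (f \<otimes>\<^bsub>thompson_T\<^esub> g) (vine_leaf (2 ^ Suc k) i) (binary_word (Suc k) i)"
    if "i < 2 ^ Suc k" for i
  proof -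
    have "i div 2 < 2 ^ k" using that by auto
    moreover have "2 * (i div 2) + of_bool (odd i) = i" by (cases "even i") auto
    ultimately have "replaces g (vine_leaf (2 ^ Suc k) i) (vine_leaf (2 ^ k) (i div 2) @ [odd i])"
      using g(2)[of "i div 2" "odd i"] by simp
    moreover have "replaces f (vine_leaf (2 ^ k) (i div 2) @ [odd i]) (binary_word (Suc k) i)"
      using replaces_append[OF f(2)] \<open>i div 2 < 2 ^ k\<close> by simp
    ultimately show ?thesis
      using short_replaces_mult[OF f(1) g(1)] by blast
  qed
  ultimately show ?case by blast
qed

lemma circle_in_binary:
  assumes "t \<in> circle"
  obtains i s where "i < 2 ^ k" "s \<in> circle" "t = point (binary_word k i) s"
proof
  define i where "i = nat \<lfloor>t * 2 ^ k\<rfloor>"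
  have *: "0 \<le> t * 2 ^ k" "t * 2 ^ k < 2 ^ k"
    using assms by (auto simp: circle_def)
  then have i: "real i = of_int \<lfloor>t * 2 ^ k\<rfloor>" by (simp add: i_def)
  then have "real i < real (2 ^ k)" using * by (simp add: floor_less_iff)
  then show "i < 2 ^ k" by linarith
  then show "t = point (binary_word k i) (frac (t * 2 ^ k))"
    using i by (simp add: point_binary_word frac_def)
qed simp

lemma rotation_replaces_binary:
  assumes "i < 2 ^ k"
  shows "replaces (rotation (real m / 2 ^ k)) (binary_word k i) (binary_word k ((i + m) mod 2 ^ k))"
  unfolding replaces_def
proof
  fix s :: real assume s: "s \<in> circle"
  define j where "j = (i + m) mod 2 ^ k"
  have j: "j < 2 ^ k" by (simp add: j_def)
  have "real (i + m) = real (j + 2 ^ k * ((i + m) div 2 ^ k))"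
    unfolding j_def by (simp only: mod_mult_div_eq)
  then have "real i + real m = real j + 2 ^ k * real ((i + m) div 2 ^ k)" by simp
  then have "(real i + s) / 2 ^ k + real m / 2 ^ k
      = (real j + s) / 2 ^ k + of_int (int ((i + m) div 2 ^ k))"
    by (simp add: field_simps)
  then have "rotation (real m / 2 ^ k) (point (binary_word k i) s) = frac ((real j + s) / 2 ^ k)"
    using assms point_in_circle[OF s, of "binary_word k i"]
    by (simp add: rotation_def point_binary_word frac_add_of_int_right del: of_int_of_nat_eq)
  also have "\<dots> = point (binary_word k j) s"
    using point_in_circle[OF s, of "binary_word k j"] j frac_circle by (simp add: point_binary_word)
  finally show "rotation (real m / 2 ^ k) (point (binary_word k i) s) = point (binary_word k j) s" .
qed

text \<open>
  The rotation shifts the words of length \<open>k\<close> cyclically, so it is the conjugate of the cyclic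
  shift of the leaves of a vine by the map that unfolds the vine; an element of \<open>T\<close> is
  determined by its action on the words of length \<open>k\<close>.
\<close>

lemma short_rotation: "short (14 * 2 ^ k) (rotation (real m / 2 ^ k))"
proof -
  obtain p where p: "short (3 * 2 ^ k) p"
    "\<And>i. i < 2 ^ k \<Longrightarrow> replaces p (vine_leaf (2 ^ k) i) (binary_word k i)"
    using unfold_vine by blast
  obtain r where r: "short (8 * 2 ^ k) r"
    "\<And>i. i < 2 ^ k \<Longrightarrow> replaces r (vine_leaf (2 ^ k) i) (vine_leaf (2 ^ k) ((i + m) mod 2 ^ k))"
    using rotate_vine[of "2 ^ k" m] by auto
  define q where "q = r \<otimes>\<^bsub>thompson_T\<^esub> inv\<^bsub>thompson_T\<^esub> p"
  define f where "f = p \<otimes>\<^bsub>thompson_T\<^esub> q"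
  have q: "short (8 * 2 ^ k + 3 * 2 ^ k) q"
    unfolding q_def by (rule short_mult[OF r(1) short_inv[OF p(1)]])
  have f: "short (3 * 2 ^ k + (8 * 2 ^ k + 3 * 2 ^ k)) f"
    unfolding f_def by (rule short_mult[OF p(1) q])
  have rep: "replaces f (binary_word k i) (binary_word k ((i + m) mod 2 ^ k))" if i: "i < 2 ^ k" for i
    unfolding f_def
    using short_replaces_mult[OF p(1) q _ p(2)]
      short_replaces_mult[OF r(1) short_inv[OF p(1)]
        short_replaces_inv[OF p(1) p(2)[OF i]] r(2)[OF i]] q_def by simp
  have "rotation (real m / 2 ^ k) = f"
  proof (rule T_eqI)
    show "rotation (real m / 2 ^ k) \<in> thompson_T_carrier"
    proof (rule rotation_in_T)
      show "real m / 2 ^ k \<in> dyadic_rationals"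
        unfolding dyadic_rationals_def by (auto intro!: exI[of _ "int m"])
    qed
    show "f \<in> thompson_T_carrier" by (rule short_in_T[OF f])
    fix t assume "t \<in> circle"
    then obtain i s where "i < 2 ^ k" "s \<in> circle" "t = point (binary_word k i) s"
      by (rule circle_in_binary)
    then show "rotation (real m / 2 ^ k) t = f t"
      using rep rotation_replaces_binary unfolding replaces_def by simp
  qed
  then show ?thesis using f by simp
qed

section \<open>Elements of \<open>T\<close> replace all long prefixes\<close>

lemma dyadics_common_denominator:
  assumes "finite D" "D \<subseteq> dyadic_rationals"
  shows "\<exists>n. \<forall>t\<in>D. \<exists>a::int. t = of_int a / 2 ^ n"
  using assms
proof (induction D rule: finite_induct)
  case (insert x D)
  then obtain n where n: "\<forall>t\<in>D. \<exists>a::int. t = of_int a / 2 ^ n" by auto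
  obtain b :: int and m where x: "x = of_int b / 2 ^ m"
    using insert.prems by (auto simp: dyadic_rationals_def)
  have *: "of_int c / 2 ^ i = of_int (c * 2 ^ j) / (2::real) ^ (i + j)" for c :: int and i j
    by (simp add: power_add)
  have "\<exists>a::int. t = of_int a / 2 ^ (n + m)" if "t \<in> insert x D" for t
    using that n x *[of _ n m] *[of _ m n] by (metis add.commute insertE)
  then show ?case by blast
qed simp

lemma cis_eq_iff_frac: "cis (2 * pi * x) = cis (2 * pi * y) \<longleftrightarrow> frac x = frac y"
proof
  assume "cis (2 * pi * x) = cis (2 * pi * y)"
  then have "sin (2 * pi * x) = sin (2 * pi * y) \<and> cos (2 * pi * x) = cos (2 * pi * y)"
    by (simp add: complex_eq_iff)
  then obtain n :: int where "2 * pi * x = 2 * pi * y + 2 * pi * of_int n"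
    by (auto simp: sin_cos_eq_iff)
  then have "2 * pi * x = 2 * pi * (y + of_int n)"
    by (simp add: algebra_simps)
  then have "x = y + of_int n" by simp
  then show "frac x = frac y" by simp
next
  have *: "cis (2 * pi * frac x) = cis (2 * pi * x)" for x
  proof -
    have "2 * pi * x = 2 * pi * frac x + 2 * pi * of_int \<lfloor>x\<rfloor>"
      by (simp add: frac_def algebra_simps)
    moreover have "cis (2 * pi * of_int \<lfloor>x\<rfloor>) = 1" by (rule cis_multiple_2pi) simp
    ultimately show ?thesis
      using cis_mult[of "2 * pi * frac x" "2 * pi * of_int \<lfloor>x\<rfloor>"] by simp
  qed
  assume "frac x = frac y"
  then show "cis (2 * pi * x) = cis (2 * pi * y)" by (metis *)
qed

text \<open>
  Points of the circle are compared as complex numbers of modulus 1, where limits are unique; this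
  avoids having to know that the quotient topology of the circle is Hausdorff.
\<close>

lemma continuous_on_cis_T:
  assumes "f \<in> thompson_T_carrier"
  shows "continuous_on UNIV (\<lambda>t. cis (2 * pi * f (frac t)))"
proof -
  have "continuous_map (top_of_set {0..1}) euclidean ((\<lambda>x. cis (2 * pi * x)) \<circ> frac)"
    by (rule continuous_map_eq[of _ _ "\<lambda>t. cis (2 * pi * t)"])
      (auto simp: cis_eq_iff_frac intro!: continuous_intros)
  then have "continuous_map circle_topology euclidean (\<lambda>x. cis (2 * pi * x))"
    by (rule continuous_compose_quotient_map[OF quotient_map_frac])
  moreover have "continuous_map euclidean circle_topology (f \<circ> frac)"
    using continuous_map_compose[OF continuous_map_frac]
      T_D(2)[OF assms] homeomorphic_imp_continuous_map by blast
  ultimately have "continuous_map euclidean euclidean ((\<lambda>x. cis (2 * pi * x)) \<circ> (f \<circ> frac))"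
    by (rule continuous_map_compose[rotated])
  then show ?thesis by (simp add: o_def)
qed

text \<open>
  Slope and offset are locally constant on the open interval, which is connected, hence constant;
  the formula extends to the left end point by continuity.
\<close>

lemma affine_between_breakpoints:
  assumes f: "f \<in> thompson_T_carrier" and ab: "0 \<le> a" "a < b" "b \<le> 1"
    and bp: "{a<..<b} \<inter> breakpoints f = {}"
  shows "\<exists>k::int. \<forall>t\<in>{a..<b}. f t = frac (f a + 2 powi k * (t - a))"
proof -
  let ?I = "{a<..<b}"
  have I: "t \<in> circle" "frac t = t" if "t \<in> ?I" for t
    using that ab by (auto simp: circle_def intro!: frac_eq[THEN iffD2])
  have "\<forall>t\<in>?I. \<exists>m. locally_affine_at f m t"
    using bp I(1) by (auto simp: breakpoints_def)
  then obtain m where m: "\<And>t. t \<in> ?I \<Longrightarrow> locally_affine_at f (m t) t" by metis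
  have within: "\<forall>\<^sub>F s in at t within ?I. P s" if "\<forall>\<^sub>F s in nhds t. s \<in> ?I \<longrightarrow> P s" for t P
    using that by (simp add: eventually_at_filter eventually_mono)
  have m_const: "m s = m t" if "s \<in> ?I" "t \<in> ?I" for s t
  proof (rule connected_local_const[of ?I _ _ m])
    show "\<forall>t\<in>?I. \<forall>\<^sub>F s in at t within ?I. m t = m s"
    proof
      fix t assume t: "t \<in> ?I"
      show "\<forall>\<^sub>F s in at t within ?I. m t = m s"
        using locally_affine_nearby[OF m[OF t] I(1)[OF t]]
        by (intro within, elim eventually_mono) (metis I(2) m locally_affine_unique)
    qed
  qed (use that in auto)
  \<comment> \<open>The midpoint serves as a reference point inside the interval.\<close>
  define M where "M = m ((a + b) / 2)"
  have M: "locally_affine_at f M t" if "t \<in> ?I" for t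
    using m[OF that] m_const[of "(a + b) / 2" t] that ab by (simp add: M_def)
  obtain k :: int where k: "M = 2 powi k"
    using T_D(6)[OF f I(1) M, of "(a + b) / 2"] ab by auto
  have frac_shift: "frac (frac x + y) = frac (x + y)" for x y :: real
    by (rule frac_add_frac_left)
  define c where "c = frac (f ((a + b) / 2) - M * ((a + b) / 2))"
  have c: "frac (f t - M * t) = c" if "t \<in> ?I" for t
    unfolding c_def
  proof (rule connected_local_const[of ?I _ _ "\<lambda>t. frac (f t - M * t)"])
    show "\<forall>t\<in>?I. \<forall>\<^sub>F s in at t within ?I. frac (f t - M * t) = frac (f s - M * s)"
    proof
      fix t assume t: "t \<in> ?I"
      show "\<forall>\<^sub>F s in at t within ?I. frac (f t - M * t) = frac (f s - M * s)"
        using M[OF t] unfolding locally_affine_at_def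
      proof (intro within, elim eventually_mono, intro impI)
        fix s assume s: "f (frac s) = frac (f t + M * (s - t))" "s \<in> ?I"
        have "frac (f s - M * s) = frac (frac (f t + M * (s - t)) + (- (M * s)))"
          using s I(2)[OF s(2)] by simp
        also have "\<dots> = frac (f t - M * t)"
          unfolding frac_shift by (simp add: algebra_simps)
        finally show "frac (f t - M * t) = frac (f s - M * s)" ..
      qed
    qed
  qed (use that ab in auto)
  have f_eq: "f t = frac (c + M * t)" if "t \<in> ?I" for t
    using frac_shift[of "f t - M * t" "M * t"] c[OF that] T_closed[OF f I(1)[OF that]] by simp
  have "cis (2 * pi * f (frac a)) = cis (2 * pi * (c + M * a))"
  proof (rule tendsto_unique[OF trivial_limit_at_right_real])
    show "((\<lambda>t. cis (2 * pi * f (frac t))) \<longlongrightarrow> cis (2 * pi * f (frac a))) (at_right a)"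
      using continuous_on_cis_T[OF f]
      by (meson UNIV_I continuous_on_def tendsto_within_subset top_greatest)
    have "((\<lambda>t. cis (2 * pi * (c + M * t))) \<longlongrightarrow> cis (2 * pi * (c + M * a))) (at_right a)"
      by (intro tendsto_intros)
    moreover have "\<forall>\<^sub>F t in at_right a. cis (2 * pi * (c + M * t)) = cis (2 * pi * f (frac t))"
      using eventually_at_right_real[OF ab(2)]
      by (rule eventually_mono) (use f_eq I in \<open>auto simp: cis_eq_iff_frac\<close>)
    ultimately show "((\<lambda>t. cis (2 * pi * f (frac t))) \<longlongrightarrow> cis (2 * pi * (c + M * a))) (at_right a)"
      using tendsto_cong by force
  qed
  moreover have a: "a \<in> circle" using ab by (simp add: circle_def)
  ultimately have fa: "f a = frac (c + M * a)"
    using T_closed[OF f a] by (simp add: cis_eq_iff_frac)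
  have "f t = frac (f a + M * (t - a))" if "t \<in> {a..<b}" for t
  proof (cases "t = a")
    case False
    then have "f t = frac (c + M * t)" using f_eq that by simp
    also have "\<dots> = frac (frac (c + M * a) + M * (t - a))"
      unfolding frac_shift by (simp add: algebra_simps)
    finally show ?thesis using fa by simp
  qed (use fa in simp)
  then show ?thesis using k by blast
qed

lemma every_word_binary: "\<exists>i < 2 ^ length w. w = binary_word (length w) i"
proof (induction w rule: rev_induct)
  case (snoc b w)
  then obtain i where i: "i < 2 ^ length w" "w = binary_word (length w) i" by blast
  then have "2 * i + of_bool b < 2 ^ length (w @ [b])" by (cases b) auto
  moreover have "w @ [b] = binary_word (length (w @ [b])) (2 * i + of_bool b)"
    using i(2) by (cases b) auto
  ultimately show ?case by blast
qed simp

text \<open>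
  The inner nodes of the domain tree in the reduced tree pair diagram of \<open>f\<close>.
\<close>

definition unreplaced :: "(real \<Rightarrow> real) \<Rightarrow> bool list set" where
  "unreplaced f = {w. \<nexists>v. replaces f w v}"

lemma int_div_mod_divide:
  "(of_int E + s) / (2::real) ^ p = (of_int (E mod 2 ^ p) + s) / 2 ^ p + of_int (E div 2 ^ p)"
proof -
  have "(of_int E :: real) = of_int (E mod 2 ^ p + 2 ^ p * (E div 2 ^ p))"
    by (simp only: mod_mult_div_eq)
  also have "\<dots> = of_int (E mod 2 ^ p) + 2 ^ p * of_int (E div 2 ^ p)"
    by (simp only: of_int_add of_int_mult of_int_power of_int_numeral)
  finally have eq: "(of_int E :: real) = of_int (E mod 2 ^ p) + 2 ^ p * of_int (E div 2 ^ p)" .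
  show ?thesis unfolding eq[THEN arg_cong, of "\<lambda>x. (x + s) / 2 ^ p"]
    by (simp add: add_divide_distrib)
qed

text \<open>
  On the interval, \<open>f\<close> has a slope \<open>2^k\<close> and a dyadic value \<open>B/2^q\<close> at the left end. An interval of
  length \<open>2^-(n+j)\<close> in it is mapped to one of length \<open>2^-p\<close> with \<open>p = n + j - k\<close>, whose left end is
  a multiple of \<open>2^-p\<close> as soon as \<open>p \<ge> q\<close>; then the image is a standard dyadic interval.
\<close>

lemma long_words_replaced_within:
  assumes f: "f \<in> thompson_T_carrier" and i: "i < 2 ^ n"
    and bp: "{real i / 2 ^ n<..<(real i + 1) / 2 ^ n} \<inter> breakpoints f = {}"
  shows "\<exists>J. \<forall>u. J \<le> length u \<longrightarrow> binary_word n i @ u \<notin> unreplaced f"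
proof -
  define a where "a = real i / 2 ^ n"
  have "real (i + 1) \<le> real (2 ^ n)" using i by (simp only: of_nat_le_iff)
  then have ab: "0 \<le> a" "a < (real i + 1) / 2 ^ n" "(real i + 1) / 2 ^ n \<le> 1"
    by (simp_all add: a_def divide_strict_right_mono)
  obtain k :: int where k:
    "\<And>t. t \<in> {a..<(real i + 1) / 2 ^ n} \<Longrightarrow> f t = frac (f a + 2 powi k * (t - a))"
    using affine_between_breakpoints[OF f ab bp[folded a_def]] by blast
  have "a \<in> dyadic_rationals"
    unfolding a_def dyadic_rationals_def by (auto intro!: exI[of _ "int i"])
  moreover have "a \<in> circle"
    using ab by (auto simp: circle_def intro: less_le_trans)
  ultimately have "f a \<in> dyadic_rationals"
    using T_D(7)[OF f] by blast
  then obtain B :: int and q where B: "f a = of_int B / 2 ^ q"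
    by (auto simp: dyadic_rationals_def)
  have "binary_word n i @ u \<notin> unreplaced f" if u: "q + nat \<bar>k\<bar> \<le> length u" for u
  proof -
    obtain l where l: "l < 2 ^ length u" "u = binary_word (length u) l"
      using every_word_binary by blast
    define p where "p = nat (int (n + length u) - k)"
    have p: "int p = int (n + length u) - k" "q \<le> p" using u by (auto simp: p_def)
    have "k + int p = int (n + length u)" using p(1) by simp
    moreover have "(2::real) powi (k + int p) = 2 powi k * 2 powi int p"
      by (rule power_int_add) simp
    ultimately have "(2::real) powi k * 2 ^ p = 2 ^ (n + length u)"
      by (simp only: power_int_of_nat)
    then have pk: "2 powi k / 2 ^ (n + length u) = 1 / (2::real) ^ p"
      by (simp add: frac_eq_eq)
    define E where "E = B * 2 ^ (p - q) + int l"
    define v where "v = binary_word p (nat (E mod 2 ^ p))"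
    have "f (point (binary_word n i @ u) s) = point v s" if s: "s \<in> circle" for s
    proof -
      have "point u s \<in> circle" using s by (rule point_in_circle)
      then have s': "0 \<le> point u s" "point u s < 1" by (auto simp: circle_def)
      have us: "point u s = (real l + s) / 2 ^ length u"
        using l by (metis point_binary_word)
      have eq: "point (binary_word n i @ u) s = a + point u s / 2 ^ n"
        using i by (simp add: point_append point_binary_word a_def add_divide_distrib)
      have "point u s / 2 ^ n < 1 / 2 ^ n"
        using s' by (simp add: divide_strict_right_mono)
      then have mem: "a + point u s / 2 ^ n \<in> {a..<(real i + 1) / 2 ^ n}"
        using s'(1) unfolding a_def add_divide_distrib atLeastLessThan_iff
        by (intro conjI add_strict_left_mono) auto
      have "2 powi k * (point u s / 2 ^ n) = (2 powi k / 2 ^ (n + length u)) * (real l + s)"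
        by (simp add: us power_add)
      also have "\<dots> = (real l + s) / 2 ^ p"
        unfolding pk by simp
      finally have "2 powi k * (point u s / 2 ^ n) = (real l + s) / 2 ^ p" .
      moreover have "f a = of_int (B * 2 ^ (p - q)) / 2 ^ p"
      proof -
        have "(2::real) ^ p = 2 ^ (p - q) * 2 ^ q" using p(2) by (simp flip: power_add)
        then show ?thesis by (simp add: B)
      qed
      ultimately have sum: "f a + 2 powi k * (point u s / 2 ^ n) = (of_int E + s) / 2 ^ p"
        by (simp add: E_def add_divide_distrib)
      have "nat (E mod 2 ^ p) < 2 ^ p"
        by (simp add: nat_less_iff)
      then have v: "point v s = (of_int (E mod 2 ^ p) + s) / 2 ^ p"
        by (simp add: v_def point_binary_word)
      have "f (point (binary_word n i @ u) s) = frac (f a + 2 powi k * (point u s / 2 ^ n))"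
        using k[OF mem] unfolding eq add_diff_cancel_left' .
      also have "\<dots> = frac (point v s)"
        unfolding sum v int_div_mod_divide[of E s p] by (rule frac_add_of_int_right)
      also have "\<dots> = point v s"
        by (rule frac_circle[OF point_in_circle[OF s]])
      finally show ?thesis .
    qed
    then have "replaces f (binary_word n i @ u) v"
      unfolding replaces_def by blast
    then show ?thesis
      unfolding unreplaced_def by blast
  qed
  then show ?thesis by blast
qed

text \<open>
  A common denominator \<open>2^n\<close> of the breakpoints cuts the circle into finitely many intervals
  without interior breakpoints; the largest of their depths works for all of them.
\<close>

lemma long_words_replaced:
  assumes f: "f \<in> thompson_T_carrier"
  shows "\<exists>n. \<forall>w. n \<le> length w \<longrightarrow> w \<notin> unreplaced f"
proof -
  obtain n where n: "\<And>t. t \<in> breakpoints f \<Longrightarrow> \<exists>a::int. t = of_int a / 2 ^ n"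
    using dyadics_common_denominator[OF T_D(4,5)[OF f]] by blast
  have "{real i / 2 ^ n<..<(real i + 1) / 2 ^ n} \<inter> breakpoints f = {}" for i
  proof -
    have False if "real i / 2 ^ n < of_int a / 2 ^ n" "of_int a / 2 ^ n < (real i + 1) / 2 ^ n" for a :: int
    proof -
      have "real i < of_int a" "of_int a < real i + 1"
        using that by (auto simp: divide_less_cancel)
      then have "int i < a" "a < int i + 1" by linarith+
      then show False by linarith
    qed
    then show ?thesis using n by force
  qed
  then have "\<forall>i. \<exists>J. i < 2 ^ n \<longrightarrow> (\<forall>u. J \<le> length u \<longrightarrow> binary_word n i @ u \<notin> unreplaced f)"
    using long_words_replaced_within[OF f] by blast
  then obtain J where J: "\<And>i u. i < 2 ^ n \<Longrightarrow> J i \<le> length u \<Longrightarrow> binary_word n i @ u \<notin> unreplaced f"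
    by metis
  define m where "m = Max (J ` {..<2 ^ n})"
  have m: "J i \<le> m" if "i < 2 ^ n" for i
    unfolding m_def using that by (intro Max_ge) auto
  have "w \<notin> unreplaced f" if w: "n + m \<le> length w" for w
  proof -
    obtain i where i: "i < 2 ^ n" "take n w = binary_word n i"
      using every_word_binary[of "take n w"] w by (metis add_leD1 length_take min.absorb2)
    have "binary_word n i @ drop n w \<notin> unreplaced f"
      using J[OF i(1), of "drop n w"] m[OF i(1)] w by simp
    then show ?thesis using i(2) by (metis append_take_drop_id)
  qed
  then show ?thesis by blast
qed

lemma finite_unreplaced:
  assumes "f \<in> thompson_T_carrier" shows "finite (unreplaced f)"
proof -
  obtain n where n: "\<forall>w. n \<le> length w \<longrightarrow> w \<notin> unreplaced f"
    using long_words_replaced[OF assms] ..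
  have "length w \<le> n" if "w \<in> unreplaced f" for w
    using n that nat_le_linear[of n "length w"] by metis
  then have "unreplaced f \<subseteq> {w. set w \<subseteq> UNIV \<and> length w \<le> n}"
    by auto
  then show ?thesis
    using finite_lists_length_le[of "UNIV :: bool set" n] finite_subset by auto
qed

section \<open>The elements \<open>x0\<close>, \<open>x1\<close>, \<open>c1\<close> generate \<open>T\<close>\<close>

lemma vine_leaf_less:
  assumes "i < l" "l < N" "s \<in> circle" "s' \<in> circle"
  shows "point (vine_leaf N i) s < point (vine_leaf N l) s'"
  using assms
proof (induction N arbitrary: i l)
  case (Suc N)
  then obtain l' where l: "l = Suc l'" by (cases l) auto
  show ?case
  proof (cases i)
    case 0
    then show ?thesis
      using Suc.prems l point_in_circle[of s' "vine_leaf N l'"]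
      by (auto simp: vine_leaf_0 circle_def)
  next
    case (Suc i')
    then show ?thesis using Suc.IH[of i' l'] Suc.prems l by simp
  qed
qed simp

lemma circle_in_vine:
  assumes "N \<ge> 1" "t \<in> circle"
  shows "\<exists>i<N. \<exists>s\<in>circle. t = point (vine_leaf N i) s"
  using assms
proof (induction N arbitrary: t rule: nat_induct_at_least)
  case base
  then show ?case by (auto simp: vine_leaf_0)
next
  case (Suc N)
  show ?case
  proof (cases "t < 1/2")
    case True
    then show ?thesis
      using Suc by (intro exI[of _ 0] conjI bexI[of _ "2 * t"]) (auto simp: vine_leaf_0 circle_def)
  next
    case False
    then have "2 * t - 1 \<in> circle" using Suc.prems by (auto simp: circle_def)
    then obtain i s where "i < N" "s \<in> circle" "2 * t - 1 = point (vine_leaf N i) s"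
      using Suc.IH by blast
    then show ?thesis by (intro exI[of _ "Suc i"] conjI bexI[of _ s]) auto
  qed
qed

lemma vine_images_antichain:
  assumes f: "f \<in> thompson_T_carrier" and il: "i < N" "l < N"
    and "replaces f (vine_leaf N i) (v @ z)" "replaces f (vine_leaf N l) v"
  shows "i = l"
proof -
  have 0: "0 \<in> circle" by (simp add: circle_def)
  then have z: "point z 0 \<in> circle" by (rule point_in_circle)
  have "f (point (vine_leaf N i) 0) = f (point (vine_leaf N l) (point z 0))"
    using assms(4,5) 0 z by (simp add: replaces_def point_append)
  then have eq: "point (vine_leaf N i) 0 = point (vine_leaf N l) (point z 0)"
    by (rule T_inj[OF f point_in_circle[OF 0] point_in_circle[OF z]])
  show ?thesis
    using vine_leaf_less[OF _ il(2) 0 z, of i] vine_leaf_less[OF _ il(1) z 0, of l] eq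
    by (cases i l rule: linorder_cases) auto
qed

text \<open>
  Take an image of maximal depth. The image that meets its sibling interval is not deeper, so it is
  the sibling or contains it; in the second case it would contain the parent and overlap the
  chosen image.
\<close>

lemma vine_images_siblings:
  assumes f: "f \<in> thompson_T_carrier" and N: "N \<ge> 2"
    and v: "\<And>i. i < N \<Longrightarrow> replaces f (vine_leaf N i) (v i)"
  obtains i j u where "i < N" "j < N" "v i = u @ [False]" "v j = u @ [True]"
proof -
  have antichain: "i = l" if "i < N" "l < N" "v i = v l @ z" for i l z
    using vine_images_antichain[OF f that(1,2)] v[OF that(1)] v[OF that(2)] that(3) by simp
  define m where "m = Max ((length \<circ> v) ` {..<N})"
  have "m \<in> (length \<circ> v) ` {..<N}"
    unfolding m_def using N by (intro Max_in) (auto simp: lessThan_empty_iff)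
  then obtain i where i: "i < N" "length (v i) = m" by auto
  have len: "length (v l) \<le> length (v i)" if "l < N" for l
    unfolding i(2) m_def using that by (intro Max_ge) auto
  have "v i \<noteq> []"
  proof
    assume e: "v i = []"
    have "\<exists>l<N. l \<noteq> i"
      using N by (intro exI[of _ "if i = 0 then 1 else 0"]) auto
    then obtain l where "l < N" "l \<noteq> i" by blast
    then show False using antichain[of l i "[]"] len[of l] i e by simp
  qed
  then obtain u b where ub: "v i = u @ [b]" by (cases "v i" rule: rev_cases) auto
  have "0 \<in> circle" by (simp add: circle_def)
  then have "point (u @ [\<not> b]) 0 \<in> circle" by (rule point_in_circle)
  then have "point (u @ [\<not> b]) 0 \<in> f ` circle"
    using T_D(8)[OF f] by (metis bij_betw_imp_surj_on)
  then obtain t where t: "t \<in> circle" "f t = point (u @ [\<not> b]) 0" by auto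
  obtain l s where l: "l < N" "s \<in> circle" "t = point (vine_leaf N l) s"
    using circle_in_vine[OF _ t(1), of N] N by auto
  then have "point (v l) s = point (u @ [\<not> b]) 0"
    using t v[OF l(1)] by (simp add: replaces_def)
  then obtain z where z: "u @ [\<not> b] = v l @ z"
    using point_eq_prefix[of "v l" s "u @ [\<not> b]" 0] l len[OF l(1)] ub \<open>0 \<in> circle\<close> by auto
  have "z = []"
  proof (rule ccontr)
    assume "z \<noteq> []"
    then obtain z' c where "z = z' @ [c]" by (cases z rule: rev_cases) auto
    then have "v i = v l @ (z' @ [b])" using z ub by simp
    then show False using antichain[OF i(1) l(1)] by auto
  qed
  then have "v l = u @ [\<not> b]" using z by simp
  then show ?thesis
    using that[of i l u] that[of l i u] ub i(1) l(1) by (cases b) auto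
qed

text \<open>
  If another leaf came right after the leaf \<open>i\<close>, its image would lie, by the preservation of the
  cyclic order, between every point of the interval \<open>u0\<close> and the left end of \<open>u1\<close>; but these two
  intervals touch.
\<close>

lemma siblings_adjacent:
  assumes f: "f \<in> thompson_T_carrier" and ij: "i < N" "j < N"
    and i: "replaces f (vine_leaf N i) (u @ [False])"
    and j: "replaces f (vine_leaf N j) (u @ [True])"
  shows "j = Suc i mod N"
proof (rule ccontr)
  assume neq: "j \<noteq> Suc i mod N"
  have "i \<noteq> j" using replaces_unique[OF i] j by auto
  define m where "m = Suc i mod N"
  have m: "m < N" "m \<noteq> j" using ij neq by (auto simp: m_def)
  have m_cases: "m = Suc i \<or> i = N - 1 \<and> m = 0"
    using ij by (cases "Suc i = N") (auto simp: m_def)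
  have 0: "0 \<in> circle" by (simp add: circle_def)
  define y where "y = point (vine_leaf N m) 0"
  define z where "z = point (vine_leaf N j) 0"
  have yz: "y \<in> circle" "z \<in> circle"
    unfolding y_def z_def by (rule point_in_circle[OF 0])+
  have fz: "f z = point u (1/2)"
    using j 0 by (simp add: replaces_def z_def point_append)
  have between: "f (point (vine_leaf N i) s) < f y \<and> f y < f z" if s: "s \<in> circle" for s
  proof -
    define x where "x = point (vine_leaf N i) s"
    have x: "x \<in> circle" unfolding x_def by (rule point_in_circle[OF s])
    have less: "point (vine_leaf N k) r < point (vine_leaf N l) r'"
      if "k < l" "l < N" "r \<in> circle" "r' \<in> circle" for k l r r'
      using vine_leaf_less that by blast
    have "cyclic_order x y z"
    proof (cases "m = Suc i")
      case True
      then have "x < y" using less[of i m s 0] s 0 m by (simp add: x_def y_def)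
      moreover have "y < z \<or> z < x"
        using less[of m j 0 0] less[of j i 0 s] s 0 m ij True \<open>i \<noteq> j\<close>
        unfolding x_def y_def z_def by (cases "m < j") auto
      ultimately show ?thesis by (auto simp: cyclic_order_def)
    next
      case False
      then have "m = 0" "i = N - 1" using m_cases by auto
      then have "y < z" "z < x"
        using less[of m j 0 0] less[of j i 0 s] s 0 m ij \<open>i \<noteq> j\<close>
        unfolding x_def y_def z_def by auto
      then show ?thesis by (simp add: cyclic_order_def)
    qed
    then have "cyclic_order (f x) (f y) (f z)"
      using T_D(3)[OF f] x yz by (simp add: orientation_preserving_def)
    moreover have "f x < f z"
    proof -
      have "f x = point u (s / 2)"
        using i s by (simp add: replaces_def x_def point_append)
      then show ?thesis
        using fz s point_affine[of u "s / 2"] point_affine[of u "1 / 2"]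
        by (simp add: circle_def divide_strict_right_mono)
    qed
    ultimately show ?thesis by (auto simp: cyclic_order_def x_def)
  qed
  \<comment> \<open>The parameter at which the point \<open>f y\<close> sits in the interval \<open>u0\<close>.\<close>
  define s where "s = (f y - point u 0) * 2 ^ Suc (length u)"
  have "f (point (vine_leaf N i) 0) = point u 0"
    using i 0 by (simp add: replaces_def point_append)
  then have "0 < s" using between[OF 0] by (simp add: s_def)
  moreover have "s < 1"
    using between[OF 0] fz point_affine[of u "1/2"] by (simp add: s_def field_simps)
  ultimately have s: "s \<in> circle" by (simp add: circle_def)
  have "f (point (vine_leaf N i) s) = point u (s / 2)"
    using i s by (simp add: replaces_def point_append)
  also have "\<dots> = f y"
    by (subst point_affine) (simp add: s_def)
  finally show False using between[OF s] by simp
qed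

text \<open>
  Induction on the number of leaves. The cyclic shift \<open>r\<close> is chosen such that the two leaves with
  sibling images become the last two leaves of the vine. These are siblings themselves, so they can
  be merged, and the remaining leaves form a vine with one leaf less.
\<close>

lemma generate_if_replaces_vine:
  assumes "N \<ge> 1" "f \<in> thompson_T_carrier"
    and "\<And>i. i < N \<Longrightarrow> \<exists>v. replaces f (vine_leaf N i) v"
  shows "f \<in> generate thompson_T gens"
  using assms
proof (induction N arbitrary: f rule: nat_induct_at_least)
  case base
  then obtain v where "replaces f (vine_leaf 1 0) v" by auto
  then have "f = \<one>\<^bsub>thompson_T\<^esub>"
    using T_replaces_all[OF base(1)] by (simp add: vine_leaf_0)
  then show ?case by (simp add: generate.one)
next
  case (Suc N)
  then obtain v where v: "\<And>i. i < Suc N \<Longrightarrow> replaces f (vine_leaf (Suc N) i) (v i)"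
    by metis
  have "2 \<le> Suc N" using Suc.hyps by simp
  then obtain i j u where ij: "i < Suc N" "j < Suc N" "v i = u @ [False]" "v j = u @ [True]"
    using vine_images_siblings[OF Suc.prems(1) _ v] by metis
  have j: "j = Suc i mod Suc N"
    using siblings_adjacent[OF Suc.prems(1) ij(1,2)] v[OF ij(1)] v[OF ij(2)] ij(3,4) by metis
  \<comment> \<open>Shifting by \<open>i + 2\<close> sends the last two leaves, with indices \<open>N - 1\<close> and \<open>N\<close>, to \<open>i\<close> and
    its cyclic successor modulo \<open>N + 1\<close>.\<close>
  obtain r where r: "short (8 * Suc N) r" "\<And>l. l < Suc N \<Longrightarrow>
      replaces r (vine_leaf (Suc N) l) (vine_leaf (Suc N) ((l + (i + 2)) mod Suc N))"
    using rotate_vine[of "Suc N" "i + 2"] by auto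
  have rT: "r \<in> thompson_T_carrier" by (rule short_in_T[OF r(1)])
  define g where "g = f \<otimes>\<^bsub>thompson_T\<^esub> r"
  have gT: "g \<in> thompson_T_carrier"
    using T.m_closed[of f r] Suc.prems(1) rT by (simp add: g_def)
  have g: "replaces g (vine_leaf (Suc N) l) (v ((l + (i + 2)) mod Suc N))" if "l < Suc N" for l
    unfolding g_def by (rule replaces_mult[OF Suc.prems(1) rT r(2)[OF that] v]) simp
  obtain M where M: "N = Suc M" using Suc.hyps by (cases N) auto
  have "g \<in> generate thompson_T gens"
  proof (rule Suc.IH[OF gT])
    fix l assume l: "l < N"
    show "\<exists>w. replaces g (vine_leaf N l) w"
    proof (cases "Suc l < N")
      case True
      then have "vine_leaf N l = vine_leaf (Suc N) l" by (simp add: vine_leaf_def)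
      then show ?thesis using g[of l] l by auto
    next
      case False
      then have lM: "l = M" using l M by simp
      have "(M + (i + 2)) mod Suc N = (i + Suc N) mod Suc N"
        "(N + (i + 2)) mod Suc N = (Suc i + Suc N) mod Suc N"
        using M by (simp_all add: add_ac)
      then have "(M + (i + 2)) mod Suc N = i" "(N + (i + 2)) mod Suc N = j"
        using ij(1) j by (simp_all only: mod_add_self2 mod_less)
      then have "replaces g (replicate M True @ [False]) (u @ [False])"
        "replaces g (replicate M True @ [True]) (u @ [True])"
        using g[of M] g[of N] ij(3,4) M
        by (simp_all add: vine_leaf_def replicate_append_same)
      then have "replaces g (replicate M True) u" by (rule replaces_halves)
      then show ?thesis using lM M by (auto simp: vine_leaf_def)
    qed
  qed
  moreover have "inv\<^bsub>thompson_T\<^esub> r \<in> generate thompson_T gens"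
    using T.expressible_generate[OF _ short_inv[OF r(1)]] gens_in_T by simp
  moreover have "f = g \<otimes>\<^bsub>thompson_T\<^esub> inv\<^bsub>thompson_T\<^esub> r"
    using Suc.prems(1) rT T.inv_closed[of r] by (simp add: g_def T.m_assoc T.r_inv)
  ultimately show ?case using generate.eng by metis
qed

text \<open>
  The words of some length \<open>n\<close> are all replaced by \<open>f\<close>, and they are the images of the leaves of
  a vine under an element of the generated subgroup.
\<close>

lemma generate_gens: "generate thompson_T gens = thompson_T_carrier"
proof
  show "generate thompson_T gens \<subseteq> thompson_T_carrier"
    using T.generate_incl[of gens] gens_in_T by simp
  show "thompson_T_carrier \<subseteq> generate thompson_T gens"
  proof
    fix f assume f: "f \<in> thompson_T_carrier"
    obtain n where n: "\<And>w. n \<le> length w \<Longrightarrow> w \<notin> unreplaced f"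
      using long_words_replaced[OF f] by blast
    obtain p where p: "short (3 * 2 ^ n) p"
      "\<And>i. i < 2 ^ n \<Longrightarrow> replaces p (vine_leaf (2 ^ n) i) (binary_word n i)"
      using unfold_vine by blast
    have pT: "p \<in> thompson_T_carrier" by (rule short_in_T[OF p(1)])
    define g where "g = f \<otimes>\<^bsub>thompson_T\<^esub> p"
    have "g \<in> generate thompson_T gens"
    proof (rule generate_if_replaces_vine[of "2 ^ n"])
      show "g \<in> thompson_T_carrier" using T.m_closed[of f p] f pT by (simp add: g_def)
      fix i :: nat assume i: "i < 2 ^ n"
      obtain v where "replaces f (binary_word n i) v"
        using n[of "binary_word n i"] by (auto simp: unreplaced_def)
      then show "\<exists>v. replaces g (vine_leaf (2 ^ n) i) v"
        unfolding g_def using replaces_mult[OF f pT p(2)[OF i]] by blast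
    qed simp
    moreover have "inv\<^bsub>thompson_T\<^esub> p \<in> generate thompson_T gens"
      using T.expressible_generate[OF _ short_inv[OF p(1)]] gens_in_T by simp
    moreover have "f = g \<otimes>\<^bsub>thompson_T\<^esub> inv\<^bsub>thompson_T\<^esub> p"
      using f pT T.inv_closed[of p] by (simp add: g_def T.m_assoc T.r_inv)
    ultimately show "f \<in> generate thompson_T gens" using generate.eng by metis
  qed
qed

section \<open>Unreplaced words bound the word length from below\<close>

text \<open>
  If \<open>f\<close> replaces \<open>u\<close> by \<open>v\<close> and \<open>g\<close> replaces \<open>v\<close>, then the product replaces \<open>u\<close>. So each
  unreplaced word of the product is one of \<open>f\<close>, or its replacement under \<open>f\<close> is one of \<open>g\<close>; and
  \<open>f\<close> never replaces two words by the same word.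
\<close>

lemma card_unreplaced_mult:
  assumes g: "g \<in> thompson_T_carrier" and f: "f \<in> thompson_T_carrier"
  shows "card (unreplaced (g \<otimes>\<^bsub>thompson_T\<^esub> f)) \<le> card (unreplaced g) + card (unreplaced f)"
proof -
  define h where "h = (\<lambda>v. SOME u. replaces f u v)"
  have h: "h v = u" if "replaces f u v" for u v
    unfolding h_def using that replaces_inj[OF f] by (intro some_equality) auto
  have "unreplaced (g \<otimes>\<^bsub>thompson_T\<^esub> f) \<subseteq> h ` unreplaced g \<union> unreplaced f"
  proof
    fix u assume u: "u \<in> unreplaced (g \<otimes>\<^bsub>thompson_T\<^esub> f)"
    show "u \<in> h ` unreplaced g \<union> unreplaced f"
    proof (cases "u \<in> unreplaced f")
      case False
      then obtain v where v: "replaces f u v" by (auto simp: unreplaced_def)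
      then have "v \<in> unreplaced g"
        using u replaces_mult[OF g f v] by (auto simp: unreplaced_def)
      then show ?thesis using h[OF v] by blast
    qed simp
  qed
  then have "card (unreplaced (g \<otimes>\<^bsub>thompson_T\<^esub> f)) \<le> card (h ` unreplaced g \<union> unreplaced f)"
    using finite_unreplaced f g by (intro card_mono) auto
  also have "\<dots> \<le> card (h ` unreplaced g) + card (unreplaced f)"
    by (rule card_Un_le)
  also have "\<dots> \<le> card (unreplaced g) + card (unreplaced f)"
    using card_image_le finite_unreplaced[OF g] by simp
  finally show ?thesis .
qed

lemma card_unreplaced_expressible:
  assumes S: "S \<subseteq> thompson_T_carrier"
    and M: "\<And>s. s \<in> S \<union> m_inv thompson_T ` S \<Longrightarrow> card (unreplaced s) \<le> M"
    and f: "expressible thompson_T S n f"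
  shows "card (unreplaced f) \<le> M * n"
proof -
  have "card (unreplaced (foldr (mult thompson_T) ws \<one>\<^bsub>thompson_T\<^esub>)) \<le> M * length ws"
    if "set ws \<subseteq> S \<union> m_inv thompson_T ` S" for ws
    using that
  proof (induction ws)
    case Nil
    have "unreplaced \<one>\<^bsub>thompson_T\<^esub> = {}"
      unfolding unreplaced_def using replaces_one by blast
    then show ?case by simp
  next
    case (Cons w ws)
    have S': "S \<union> m_inv thompson_T ` S \<subseteq> thompson_T_carrier"
      using T.letters_closed[of S] S by simp
    have "w \<in> thompson_T_carrier" using Cons.prems S' by auto
    moreover have "foldr (mult thompson_T) ws \<one>\<^bsub>thompson_T\<^esub> \<in> thompson_T_carrier"
      using T.word_closed[of ws] Cons.prems S' by auto
    ultimately show ?case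
      using card_unreplaced_mult[of w "foldr (mult thompson_T) ws \<one>\<^bsub>thompson_T\<^esub>"]
        Cons M[of w] by simp
  qed
  moreover obtain ws where "length ws \<le> n" "set ws \<subseteq> S \<union> m_inv thompson_T ` S"
    "foldr (mult thompson_T) ws \<one>\<^bsub>thompson_T\<^esub> = f"
    using f unfolding expressible_def by blast
  ultimately show ?thesis using mult_le_mono2 order_trans by blast
qed

text \<open>
  A rotation has slope 1, so it could only replace \<open>w\<close> by a word of the same length \<open>l\<close>. Then \<open>a/2^k\<close>
  would be a multiple of \<open>2^-l\<close>, which is impossible for odd \<open>a\<close> and \<open>l < k\<close>.
\<close>

lemma short_word_in_unreplaced_rotation:
  assumes "odd (a::int)" "length w < k"
  shows "w \<in> unreplaced (rotation (of_int a / 2 ^ k))"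
proof (rule ccontr)
  assume "w \<notin> unreplaced (rotation (of_int a / 2 ^ k))"
  then obtain v where v: "replaces (rotation (of_int a / 2 ^ k)) w v"
    by (auto simp: unreplaced_def)
  define d where "d = point w 0 + of_int a / 2 ^ k - point v 0"
  have int: "d + s / 2 ^ length w - s / 2 ^ length v \<in> \<int>" if s: "s \<in> circle" for s
  proof -
    have "frac (point w s + of_int a / 2 ^ k) = point v s"
    proof -
      have "rotation (of_int a / 2 ^ k) (point w s) = point v s"
        using v s by (simp add: replaces_def)
      then show ?thesis using point_in_circle[OF s, of w] by (simp add: rotation_def)
    qed
    then have "point w s + of_int a / 2 ^ k - point v s \<in> \<int>"
      by (metis Ints_of_int add_diff_cancel_right' diff_add_cancel frac_def diff_diff_eq2 add.commute)
    then show ?thesis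
      using point_affine[of w s] point_affine[of v s] by (simp add: d_def algebra_simps)
  qed
  have d: "d \<in> \<int>" using int[of 0] by (simp add: circle_def)
  \<comment> \<open>Two integers that differ by less than 1 are equal; here they are the shifts at the parameters
    0 and \<open>1/2\<close>, and equality means that the two intervals have the same length.\<close>
  have "d + 1/2 / 2 ^ length w - 1/2 / 2 ^ length v \<in> \<int>"
    using int[of "1/2"] by (simp add: circle_def)
  then have "1/2 / 2 ^ length w - 1/2 / 2 ^ length v \<in> (\<int> :: real set)"
    using d Ints_diff by (metis add_diff_cancel_left' add_diff_eq)
  moreover have b: "0 < 1/2 / (2::real) ^ m \<and> 1/2 / (2::real) ^ m \<le> 1/2" for m
    by (simp add: field_simps)
  moreover from b[of "length w"] b[of "length v"]
  have "\<bar>1/2 / 2 ^ length w - 1/2 / (2::real) ^ length v\<bar> < 1"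
    by linarith
  ultimately have "1/2 / 2 ^ length w - 1/2 / (2::real) ^ length v = 0"
    using Ints_nonzero_abs_less1 by blast
  then have len: "length v = length w" by simp
  obtain i j where ij: "i < 2 ^ length w" "w = binary_word (length w) i"
    "j < 2 ^ length w" "v = binary_word (length w) j"
    using every_word_binary[of w] every_word_binary[of v] len by auto
  have "d = real i / 2 ^ length w + of_int a / 2 ^ k - real j / 2 ^ length w"
    unfolding d_def using ij(1,3) by (subst ij(2), subst ij(4)) (simp add: point_binary_word)
  moreover obtain m :: int where "d = of_int m" using d by (auto elim: Ints_cases)
  ultimately have "of_int a / 2 ^ k = of_int m - real i / 2 ^ length w + real j / 2 ^ length w"
    by simp
  then have a: "of_int a = (of_int m - real i / 2 ^ length w + real j / 2 ^ length w) * 2 ^ k"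
    by (simp add: divide_eq_eq)
  obtain c where k: "k = length w + Suc c"
    using assms(2) less_imp_Suc_add by auto
  have "of_int a = (of_int (2 ^ Suc c * (m * 2 ^ length w + int j - int i)) :: real)"
    unfolding a k by (simp add: power_add algebra_simps)
  then have "a = 2 ^ Suc c * (m * 2 ^ length w + int j - int i)"
    by (simp only: of_int_eq_iff)
  then show False using assms(1) by simp
qed

lemma card_unreplaced_rotation:
  assumes "odd (a::int)" "a' = of_int a / 2 ^ Suc k"
  shows "2 ^ k \<le> card (unreplaced (rotation a'))"
proof -
  let ?W = "{w :: bool list. set w \<subseteq> UNIV \<and> length w = k}"
  have "?W \<subseteq> unreplaced (rotation a')"
    using short_word_in_unreplaced_rotation[OF assms(1), of _ "Suc k"] assms(2) by auto
  moreover have "finite (unreplaced (rotation a'))"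
    using assms(2) by (intro finite_unreplaced rotation_in_T) (auto simp: dyadic_rationals_def
        intro!: exI[of _ a] exI[of _ "Suc k"])
  moreover have "card ?W = 2 ^ k"
    using card_lists_length_eq[of "UNIV :: bool set" k] by simp
  ultimately show ?thesis
    using card_mono[of "unreplaced (rotation a')" ?W] by linarith
qed

section \<open>The rotations are quasi-isometrically embedded\<close>

lemma rotation_cong:
  assumes "frac d = frac e" shows "rotation d = rotation e"
proof -
  have "frac (t + d) = frac (t + e)" for t
    using frac_add_frac_left[of d t] frac_add_frac_left[of e t] assms by (simp add: add.commute)
  then show ?thesis by (simp add: rotation_def)
qed

lemma short_rotation_int: "short (14 * 2 ^ k) (rotation (of_int a / 2 ^ k))"
proof -
  have "of_int a / 2 ^ k = (of_int (a mod 2 ^ k) / 2 ^ k + of_int (a div 2 ^ k) :: real)"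
    using int_div_mod_divide[of a 0 k] by simp
  then have "frac (of_int a / 2 ^ k) = frac (of_int (a mod 2 ^ k) / 2 ^ k :: real)"
    by simp
  moreover have "of_int (a mod 2 ^ k) = real (nat (a mod 2 ^ k))" by simp
  ultimately show ?thesis
    using rotation_cong short_rotation by metis
qed

lemma dyadic_odd_form:
  assumes "x \<in> dyadic_rationals" "0 < \<bar>x\<bar>" "\<bar>x\<bar> < 1"
  obtains a :: int and k where "odd a" "x = of_int a / 2 ^ Suc k"
proof -
  have "\<exists>(b::int) k. odd b \<and> x = of_int b / 2 ^ Suc k" if "x = of_int a / 2 ^ n" for a :: int and n
    using that
  proof (induction n arbitrary: a)
    case 0
    then show ?case using assms(2,3) by (auto simp flip: of_int_abs)
  next
    case (Suc n)
    show ?case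
    proof (cases "odd a")
      case False
      then obtain b where "a = 2 * b" by blast
      then show ?thesis using Suc by simp
    qed (use Suc.prems in blast)
  qed
  then show ?thesis using that assms(1) by (auto simp: dyadic_rationals_def)
qed

theorem proposition6p3:
  shows "generate thompson_T {x0, x1, c1} = carrier thompson_T \<and>
    (\<forall>S. finite S \<and> S \<subseteq> carrier thompson_T \<and> generate thompson_T S = carrier thompson_T \<longrightarrow>
      (\<exists>K C :: real. K > 0 \<and>
        (\<forall>g\<in>dyadic_rotations. \<forall>h\<in>dyadic_rotations.
           1 / K * rotation_dist g h - C \<le> real (word_dist thompson_T S g h) \<and>
           real (word_dist thompson_T S g h) \<le> K * rotation_dist g h + C)))"
proof (intro conjI allI impI)
  show "generate thompson_T {x0, x1, c1} = carrier thompson_T"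
    by (simp add: generate_gens)
next
  fix S assume S: "finite S \<and> S \<subseteq> carrier thompson_T \<and> generate thompson_T S = carrier thompson_T"
  have "\<exists>n. expressible thompson_T S n y" if "y \<in> gens" for y
    using T.generate_expressible[of S y] S gens_in_T that by auto
  then obtain l0 l1 l2 where l: "expressible thompson_T S l0 x0" "expressible thompson_T S l1 x1"
    "expressible thompson_T S l2 c1" by (meson insertCI)
  define L where "L = l0 + l1 + l2"
  have L: "expressible thompson_T S L y" if "y \<in> gens" for y
    using that l[THEN expressible_mono, of L] by (auto simp: L_def)
  define M where "M = Max ((card \<circ> unreplaced) ` (S \<union> m_inv thompson_T ` S))"
  have M: "card (unreplaced s) \<le> M" if "s \<in> S \<union> m_inv thompson_T ` S" for s
  proof -
    have "(card \<circ> unreplaced) s \<le> M"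
      unfolding M_def using S that by (intro Max_ge finite_imageI imageI) auto
    then show ?thesis by simp
  qed
  \<comment> \<open>The factor 14 comes from the length of a rotation in the letters \<open>x0\<close>, \<open>x1\<close>, \<open>c1\<close>, and the
    factor 2 from \<open>2^k\<close> unreplaced words at distance \<open>2^(k+1)\<close>; the summand 1 makes \<open>K\<close>
    positive.\<close>
  define K :: real where "K = real (14 * L + 2 * M + 1)"
  have K: "K \<ge> 1" "K \<ge> 14 * real L" "K \<ge> 2 * real M" by (simp_all add: K_def)
  show "\<exists>K C :: real. K > 0 \<and> (\<forall>g\<in>dyadic_rotations. \<forall>h\<in>dyadic_rotations.
      1 / K * rotation_dist g h - C \<le> real (word_dist thompson_T S g h) \<and>
      real (word_dist thompson_T S g h) \<le> K * rotation_dist g h + C)"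
  proof (rule exI[of _ K], rule exI[of _ 0], intro conjI ballI)
    show "K > 0" using K by linarith
    fix g h assume "g \<in> dyadic_rotations" "h \<in> dyadic_rotations"
    then obtain d e where de: "d \<in> dyadic_rationals" "g = rotation d"
      "e \<in> dyadic_rationals" "h = rotation e"
      by (auto simp: dyadic_rotations_def)
    have "inv\<^bsub>thompson_T\<^esub> g = rotation (- d)"
    proof (rule T.inv_equality)
      show "rotation (- d) \<otimes>\<^bsub>thompson_T\<^esub> g = \<one>\<^bsub>thompson_T\<^esub>"
        using de by (simp add: mult_rotation dyadics_minus one_thompson_T)
    qed (use de rotation_in_T dyadics_minus in auto)
    then have "inv\<^bsub>thompson_T\<^esub> g \<otimes>\<^bsub>thompson_T\<^esub> h = rotation (e - d)"
      using de by (simp add: mult_rotation dyadics_minus)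
    also have "e - d = (frac e - frac d) + of_int (\<lfloor>e\<rfloor> - \<lfloor>d\<rfloor>)"
      by (simp add: frac_def)
    also have "rotation \<dots> = rotation (frac e - frac d)"
      by (rule rotation_cong) (rule frac_add_of_int_right)
    finally have gh: "word_dist thompson_T S g h = word_length thompson_T S (rotation (frac e - frac d))"
      by (simp add: word_dist_def)
    have dist: "rotation_dist g h = two_adic_dist (frac d) (frac e)"
      using de by (simp add: rotation_dist_def rotation_def circle_def)
    have "1 / K * rotation_dist g h \<le> real (word_dist thompson_T S g h) \<and>
      real (word_dist thompson_T S g h) \<le> K * rotation_dist g h"
    proof (cases "frac d = frac e")
      case True
      have "word_dist thompson_T S g h = 0"
        using word_length_le[OF expressible_one, of thompson_T S 0] True
        by (simp add: gh one_thompson_T)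
      then show ?thesis using True by (simp add: dist two_adic_dist_def)
    next
      case False
      have fr: "0 \<le> frac d" "frac d < 1" "0 \<le> frac e" "frac e < 1" by (auto simp: frac_lt_1)
      have "frac e - frac d \<in> dyadic_rationals"
        using de by (intro dyadics_diff) (simp_all add: dyadics_frac)
      moreover have "0 < \<bar>frac e - frac d\<bar>" "\<bar>frac e - frac d\<bar> < 1"
        using False fr by linarith+
      ultimately obtain a :: int and k where a: "odd a" "frac e - frac d = of_int a / 2 ^ Suc k"
        by (rule dyadic_odd_form)
      have "\<bar>frac d - frac e\<bar> = of_int \<bar>a\<bar> / 2 ^ Suc k"
        using a(2) abs_minus_commute[of "frac d"] by simp
      then have dist': "rotation_dist g h = 2 ^ Suc k"
        unfolding dist by (rule two_adic_dist_eq[rotated]) (simp add: a(1))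
      define n where "n = word_dist thompson_T S g h"
      have n: "n = word_length thompson_T S (rotation (of_int a / 2 ^ Suc k))"
        by (simp only: n_def gh a(2))
      have ex: "expressible thompson_T S (L * (14 * 2 ^ Suc k)) (rotation (of_int a / 2 ^ Suc k))"
        using S L by (intro T.expressible_change_generators[OF _ _ short_rotation_int]) auto
      then have "n \<le> L * (14 * 2 ^ Suc k)"
        unfolding n by (rule word_length_le)
      then have "real n \<le> real (L * (14 * 2 ^ Suc k))" by (simp only: of_nat_le_iff)
      also have "\<dots> = (14 * real L) * 2 ^ Suc k" by simp
      also have "\<dots> \<le> K * 2 ^ Suc k" using K by (intro mult_right_mono) auto
      finally have upper: "real n \<le> K * 2 ^ Suc k" .
      have "expressible thompson_T S n (rotation (of_int a / 2 ^ Suc k))"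
        unfolding n by (rule expressible_word_length[OF ex])
      then have "card (unreplaced (rotation (of_int a / 2 ^ Suc k))) \<le> M * n"
        using S M by (intro card_unreplaced_expressible) auto
      then have "2 ^ k \<le> M * n"
        using card_unreplaced_rotation[OF a(1) refl, of k] by linarith
      then have "real (2 ^ k) \<le> real (M * n)" by (simp only: of_nat_le_iff)
      then have "2 ^ Suc k \<le> (2 * real M) * real n" by simp
      also have "\<dots> \<le> K * real n" using K by (intro mult_right_mono) auto
      finally have "1 / K * 2 ^ Suc k \<le> real n" using K by (simp add: field_simps)
      then show ?thesis using upper by (simp only: dist' n_def)
    qed
    then show "1 / K * rotation_dist g h - 0 \<le> real (word_dist thompson_T S g h)"
      "real (word_dist thompson_T S g h) \<le> K * rotation_dist g h + 0" by simp_all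
  qed
qed

end
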